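(* Every Riemannian manifold (separable or non-separable, finite- or infinite-dimensional) is $C^1$-uniformly bumpable.
   Context: A Riemannian manifold is a paracompact smooth manifold $M$ modeled on a real Hilbert space (not necessarily separable, possibly infinite-dimensional) with a Riemannian metric $\langle\cdot,\cdot\rangle_p$ on each $T_pM$ whose norm $\|v\|_p=\langle v,v\rangle_p^{1/2}$ corresponds in charts to a norm equivalent to the Hilbert norm. The distance $d_M(p,q)$ is the infimum of the lengths $\int_a^b\|c'(t)\|_{c(t)}\,dt$ of piecewise $C^1$ paths $c:[a,b]\to M$ joining $p$ to $q$ (with value $+\infty$ if $p,q$ lie in different connected components). For a differentiable $b:M\to\mathbb{R}$, $\|db(q)\|_q=\sup\{|db(q)(v)|:v\in T_qM,\ \|v\|_q\le1\}$. $M$ is $C^1$-uniformly bumpable if there are $R>1$ and $r>0$ such that for every $p\in M$ and $\delta\in(0,r)$ there exists a $C^1$-smooth function $b:M\to[0,1]$ with $b(p)=1$, $b(q)=0$ whenever $d_M(p,q)\ge\delta$, and $\sup_{q\in M}\|db(q)\|_q\le R/\delta$. *)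

theory Defs
  imports "HOL-Analysis.Analysis"
begin

section \<open>Differentiability classes in normed spaces\<close>

text \<open>
  The \<open>k\<close>-th derivative of a map at a point is a bounded \<open>k\<close>-linear map. Since \<open>k\<close> varies, such
  maps are represented as functions on lists, of which only the values on lists of length \<open>k\<close> matter.
\<close>

definition bounded_multilinear ::
  "nat \<Rightarrow> ('a::real_normed_vector list \<Rightarrow> 'b::real_normed_vector) \<Rightarrow> bool" where
  "bounded_multilinear k T \<longleftrightarrow>
     (\<forall>vs. length vs = k \<longrightarrow> (\<forall>i<k. linear (\<lambda>v. T (vs[i := v])))) \<and>
     (\<exists>K. \<forall>vs. length vs = k \<longrightarrow> norm (T vs) \<le> K * prod_list (map norm vs))"

text \<open>
  \<open>C\<^sup>\<infinity>\<close> on an open set \<open>U\<close>: the last clause says that \<open>v \<mapsto> D (Suc k) x (v # _)\<close> is the Frechet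
  derivative at \<open>x\<close> of \<open>y \<mapsto> D k y\<close> with respect to the operator norm of \<open>k\<close>-linear maps. As this
  is required for every \<open>k\<close>, continuity of each \<open>D k\<close> is automatic.
\<close>

definition smooth_on ::
  "'a::real_normed_vector set \<Rightarrow> ('a \<Rightarrow> 'b::real_normed_vector) \<Rightarrow> bool" where
  "smooth_on U f \<longleftrightarrow>
     (\<exists>D :: nat \<Rightarrow> 'a \<Rightarrow> 'a list \<Rightarrow> 'b. \<forall>x\<in>U.
        D 0 x [] = f x \<and>
        (\<forall>k. bounded_multilinear k (D k x)) \<and>
        (\<forall>k. \<forall>e>0. \<forall>\<^sub>F y in at x. \<forall>vs. length vs = k \<longrightarrow>
           norm (D k y vs - D k x vs - D (Suc k) x ((y - x) # vs))
             \<le> e * norm (y - x) * prod_list (map norm vs)))"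

definition C1_on ::
  "'a::real_normed_vector set \<Rightarrow> ('a \<Rightarrow> 'b::real_normed_vector) \<Rightarrow> bool" where
  "C1_on U f \<longleftrightarrow>
     (\<exists>f' :: 'a \<Rightarrow> ('a \<Rightarrow>\<^sub>L 'b). continuous_on U f' \<and>
        (\<forall>x\<in>U. (f has_derivative blinfun_apply (f' x)) (at x)))"


section \<open>Smooth manifolds modeled on a Hilbert space\<close>

definition paracompact_space :: "'m topology \<Rightarrow> bool" where
  "paracompact_space X \<longleftrightarrow>
     (\<forall>\<U>. (\<forall>U\<in>\<U>. openin X U) \<and> \<Union>\<U> = topspace X \<longrightarrow>
        (\<exists>\<V>. (\<forall>V\<in>\<V>. openin X V) \<and> \<Union>\<V> = topspace X \<and>
             (\<forall>V\<in>\<V>. \<exists>U\<in>\<U>. V \<subseteq> U) \<and> locally_finite_in X \<V>))"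

text \<open>
  A chart is a pair of its domain and its coordinate map; the values of the coordinate map outside
  the domain are irrelevant.
\<close>

type_synonym ('m, 'e) chart = "'m set \<times> ('m \<Rightarrow> 'e)"

abbreviation chart_dom :: "('m, 'e) chart \<Rightarrow> 'm set" where
  "chart_dom \<equiv> fst"

abbreviation chart_map :: "('m, 'e) chart \<Rightarrow> 'm \<Rightarrow> 'e" where
  "chart_map \<equiv> snd"

definition chart_inv :: "('m, 'e) chart \<Rightarrow> 'e \<Rightarrow> 'm" where
  "chart_inv \<kappa> = inv_into (chart_dom \<kappa>) (chart_map \<kappa>)"

definition charts_at :: "('m, 'e) chart set \<Rightarrow> 'm \<Rightarrow> ('m, 'e) chart set" where
  "charts_at \<A> p = {\<kappa>\<in>\<A>. p \<in> chart_dom \<kappa>}"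

text \<open>
  The Hilbert space is any real inner product type that is complete; no separability or dimension
  restriction is imposed.
\<close>

locale hilbert_manifold =
  fixes X :: "'m topology" and \<A> :: "('m, 'e::{real_inner, banach}) chart set"
  assumes hausdorff: "Hausdorff_space X"
    and paracompact: "paracompact_space X"
    and atlas_covers: "(\<Union>\<kappa>\<in>\<A>. chart_dom \<kappa>) = topspace X"
    and open_chart_dom: "\<kappa> \<in> \<A> \<Longrightarrow> openin X (chart_dom \<kappa>)"
    and open_chart_image: "\<kappa> \<in> \<A> \<Longrightarrow> open (chart_map \<kappa> ` chart_dom \<kappa>)"
    and chart_homeomorphic: "\<kappa> \<in> \<A> \<Longrightarrow>
      homeomorphic_map (subtopology X (chart_dom \<kappa>))
        (top_of_set (chart_map \<kappa> ` chart_dom \<kappa>)) (chart_map \<kappa>)"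
    and smooth_transition: "\<kappa> \<in> \<A> \<Longrightarrow> \<mu> \<in> \<A> \<Longrightarrow>
      smooth_on (chart_map \<kappa> ` (chart_dom \<kappa> \<inter> chart_dom \<mu>)) (chart_map \<mu> \<circ> chart_inv \<kappa>)"

text \<open>
  A tangent vector at \<open>p\<close> is the family of its coordinate representations in the charts around \<open>p\<close>,
  related by the derivatives of the transition maps (and \<open>0\<close> at all other arguments, so that equal
  tangent vectors are equal functions). Addition and scaling are pointwise.
\<close>

type_synonym ('m, 'e) tangent = "('m, 'e) chart \<Rightarrow> 'e"

definition tangent_space ::
  "('m, 'e::{real_inner, banach}) chart set \<Rightarrow> 'm \<Rightarrow> ('m, 'e) tangent set" where
  "tangent_space \<A> p =
     {v. (\<forall>\<kappa>. \<kappa> \<notin> charts_at \<A> p \<longrightarrow> v \<kappa> = 0) \<and>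
         (\<forall>\<kappa>\<in>charts_at \<A> p. \<forall>\<mu>\<in>charts_at \<A> p.
            v \<mu> = frechet_derivative (chart_map \<mu> \<circ> chart_inv \<kappa>) (at (chart_map \<kappa> p)) (v \<kappa>))}"


section \<open>Riemannian manifolds\<close>

text \<open>
  The last axiom says that the metric is a smooth section of the bundle of continuous bilinear forms,
  the space of such forms carrying the operator norm.
\<close>

locale riemannian_manifold = hilbert_manifold X \<A>
  for X :: "'m topology" and \<A> :: "('m, 'e::{real_inner, banach}) chart set" +
  fixes g :: "'m \<Rightarrow> ('m, 'e) tangent \<Rightarrow> ('m, 'e) tangent \<Rightarrow> real"
  assumes metric_sym: "p \<in> topspace X \<Longrightarrow> v \<in> tangent_space \<A> p \<Longrightarrow> w \<in> tangent_space \<A> p \<Longrightarrow>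
      g p v w = g p w v"
    and metric_linear: "p \<in> topspace X \<Longrightarrow> u \<in> tangent_space \<A> p \<Longrightarrow> v \<in> tangent_space \<A> p \<Longrightarrow>
      w \<in> tangent_space \<A> p \<Longrightarrow>
      g p (\<lambda>\<kappa>. r *\<^sub>R u \<kappa> + s *\<^sub>R v \<kappa>) w = r * g p u w + s * g p v w"
    and metric_pos: "p \<in> topspace X \<Longrightarrow> v \<in> tangent_space \<A> p \<Longrightarrow> v \<noteq> (\<lambda>_. 0) \<Longrightarrow> g p v v > 0"
    and metric_equivalent: "p \<in> topspace X \<Longrightarrow> \<kappa> \<in> charts_at \<A> p \<Longrightarrow>
      \<exists>C>0. \<forall>v\<in>tangent_space \<A> p.
        norm (v \<kappa>) \<le> C * sqrt (g p v v) \<and> sqrt (g p v v) \<le> C * norm (v \<kappa>)"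
    and metric_smooth: "\<kappa> \<in> \<A> \<Longrightarrow>
      \<exists>G :: 'e \<Rightarrow> ('e \<Rightarrow>\<^sub>L ('e \<Rightarrow>\<^sub>L real)). smooth_on (chart_map \<kappa> ` chart_dom \<kappa>) G \<and>
        (\<forall>p\<in>chart_dom \<kappa>. \<forall>v\<in>tangent_space \<A> p. \<forall>w\<in>tangent_space \<A> p.
           g p v w = blinfun_apply (blinfun_apply (G (chart_map \<kappa> p)) (v \<kappa>)) (w \<kappa>))"

definition tangent_norm ::
  "('m \<Rightarrow> ('m, 'e) tangent \<Rightarrow> ('m, 'e) tangent \<Rightarrow> real) \<Rightarrow> 'm \<Rightarrow> ('m, 'e) tangent \<Rightarrow> real" where
  "tangent_norm g p v = sqrt (g p v v)"


subsection \<open>The Riemannian distance\<close>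

text \<open>\<open>C\<^sup>1\<close> up to and including the endpoints of \<open>{s..t}\<close>, where derivatives are one-sided.\<close>

definition C1_curve ::
  "'m topology \<Rightarrow> ('m, 'e::{real_inner, banach}) chart set \<Rightarrow> real \<Rightarrow> real \<Rightarrow> (real \<Rightarrow> 'm) \<Rightarrow> bool"
  where
  "C1_curve X \<A> s t c \<longleftrightarrow>
     continuous_map (top_of_set {s..t}) X c \<and>
     (\<forall>\<kappa>\<in>\<A>. \<exists>w. continuous_on {\<tau>\<in>{s..t}. c \<tau> \<in> chart_dom \<kappa>} w \<and>
        (\<forall>\<tau>\<in>{s..t}. c \<tau> \<in> chart_dom \<kappa> \<longrightarrow>
           (chart_map \<kappa> \<circ> c has_vector_derivative w \<tau>) (at \<tau> within {s..t})))"

definition piecewise_C1_path ::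
  "'m topology \<Rightarrow> ('m, 'e::{real_inner, banach}) chart set \<Rightarrow> real \<Rightarrow> real \<Rightarrow> (real \<Rightarrow> 'm) \<Rightarrow> bool"
  where
  "piecewise_C1_path X \<A> a b c \<longleftrightarrow>
     a < b \<and> continuous_map (top_of_set {a..b}) X c \<and>
     (\<exists>(n::nat) \<tau>. \<tau> 0 = a \<and> \<tau> n = b \<and>
        (\<forall>i<n. \<tau> i < \<tau> (Suc i) \<and> C1_curve X \<A> (\<tau> i) (\<tau> (Suc i)) c))"

text \<open>
  At the finitely many points where a piecewise \<open>C\<^sup>1\<close> path has no two-sided derivative the velocity
  is unspecified; this does not affect the length.
\<close>

definition velocity ::
  "('m, 'e::{real_inner, banach}) chart set \<Rightarrow> (real \<Rightarrow> 'm) \<Rightarrow> real \<Rightarrow> ('m, 'e) tangent" where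
  "velocity \<A> c t =
     (\<lambda>\<kappa>. if \<kappa> \<in> charts_at \<A> (c t) then vector_derivative (chart_map \<kappa> \<circ> c) (at t) else 0)"

definition path_length ::
  "('m, 'e::{real_inner, banach}) chart set \<Rightarrow>
   ('m \<Rightarrow> ('m, 'e) tangent \<Rightarrow> ('m, 'e) tangent \<Rightarrow> real) \<Rightarrow> real \<Rightarrow> real \<Rightarrow> (real \<Rightarrow> 'm) \<Rightarrow> real" where
  "path_length \<A> g a b c = integral {a..b} (\<lambda>t. tangent_norm g (c t) (velocity \<A> c t))"

text \<open>The infimum of the empty set in \<^typ>\<open>ereal\<close> is \<open>\<infinity>\<close>.\<close>

definition riemannian_dist ::
  "'m topology \<Rightarrow> ('m, 'e::{real_inner, banach}) chart set \<Rightarrow>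
   ('m \<Rightarrow> ('m, 'e) tangent \<Rightarrow> ('m, 'e) tangent \<Rightarrow> real) \<Rightarrow> 'm \<Rightarrow> 'm \<Rightarrow> ereal" where
  "riemannian_dist X \<A> g p q =
     Inf {ereal (path_length \<A> g a b c) | a b c. piecewise_C1_path X \<A> a b c \<and> c a = p \<and> c b = q}"


subsection \<open>Uniform bumpability\<close>

definition C1_function ::
  "('m, 'e::{real_inner, banach}) chart set \<Rightarrow> ('m \<Rightarrow> real) \<Rightarrow> bool" where
  "C1_function \<A> b \<longleftrightarrow> (\<forall>\<kappa>\<in>\<A>. C1_on (chart_map \<kappa> ` chart_dom \<kappa>) (b \<circ> chart_inv \<kappa>))"

text \<open>
  On \<^term>\<open>tangent_space \<A> q\<close> the value does not depend on the choice of the chart around \<open>q\<close>.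
\<close>

definition differential ::
  "('m, 'e::{real_inner, banach}) chart set \<Rightarrow> ('m \<Rightarrow> real) \<Rightarrow> 'm \<Rightarrow> ('m, 'e) tangent \<Rightarrow> real" where
  "differential \<A> b q v =
     (let \<kappa> = (SOME \<kappa>. \<kappa> \<in> charts_at \<A> q)
      in frechet_derivative (b \<circ> chart_inv \<kappa>) (at (chart_map \<kappa> q)) (v \<kappa>))"

definition differential_norm ::
  "('m, 'e::{real_inner, banach}) chart set \<Rightarrow>
   ('m \<Rightarrow> ('m, 'e) tangent \<Rightarrow> ('m, 'e) tangent \<Rightarrow> real) \<Rightarrow> ('m \<Rightarrow> real) \<Rightarrow> 'm \<Rightarrow> ereal" where
  "differential_norm \<A> g b q =
     (SUP v\<in>{v \<in> tangent_space \<A> q. tangent_norm g q v \<le> 1}. ereal \<bar>differential \<A> b q v\<bar>)"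

definition C1_uniformly_bumpable ::
  "'m topology \<Rightarrow> ('m, 'e::{real_inner, banach}) chart set \<Rightarrow>
   ('m \<Rightarrow> ('m, 'e) tangent \<Rightarrow> ('m, 'e) tangent \<Rightarrow> real) \<Rightarrow> bool" where
  "C1_uniformly_bumpable X \<A> g \<longleftrightarrow>
     (\<exists>R>1. \<exists>r>0. \<forall>p\<in>topspace X. \<forall>\<delta>::real. 0 < \<delta> \<and> \<delta> < r \<longrightarrow>
        (\<exists>b :: 'm \<Rightarrow> real.
           C1_function \<A> b \<and>
           (\<forall>q\<in>topspace X. 0 \<le> b q \<and> b q \<le> 1) \<and>
           b p = 1 \<and>
           (\<forall>q\<in>topspace X. riemannian_dist X \<A> g p q \<ge> ereal \<delta> \<longrightarrow> b q = 0) \<and>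
           (SUP q\<in>topspace X. differential_norm \<A> g b q) \<le> ereal (R / \<delta>)))"

end

theory Submission
  imports Defs
begin

text \<open>
  Let \<open>f q = min \<delta> (d(p, q))\<close>. In a small chart the metric is within a factor \<open>2\<close> of a constant
  inner product \<open>B\<close>, and joining points by coordinate segments shows that \<open>f\<close> is \<open>2\<close>-Lipschitz for the
  norm of \<open>B\<close>. It suffices to find a \<open>C\<^sup>1\<close> function \<open>T\<close> with \<open>f \<le> T \<le> f + \<delta>/4\<close> and
  \<open>\<parallel>dT\<parallel>\<close> bounded by an absolute constant, and to compose it with a cutoff function.

  Take a locally finite open cover by sets \<open>V\<close> whose closures lie in such charts, and numbers \<open>\<eta>\<^sub>n \<rightarrow> 0\<close>.
  Lasry-Lions regularization of \<open>f + 5 min(dist(\<cdot>, -V), \<eta>\<^sub>n)\<close> in the Hilbert space \<open>(E, B)\<close>, lowered by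
  \<open>\<eta>\<^sub>n\<close>, gives a \<open>C\<^sup>1\<close> function \<open>G\<^sub>V\<^sub>,\<^sub>n\<close> that is at most \<open>f\<close> off \<open>V\<close>, at most \<open>f + 5 \<eta>\<^sub>n\<close> everywhere,
  and at least \<open>f + 3 \<eta>\<^sub>n\<close> at depth \<open>\<eta>\<^sub>n\<close> inside \<open>V\<close>. Near a given point some \<open>G\<^sub>V\<^sub>,\<^sub>m\<close> is at least
  \<open>f + 3 \<eta>\<^sub>m\<close>, so that only finitely many of the functions compete for the maximum there.
  The function \<open>T\<close> is a smoothed maximum, whose differential is a convex combination of the
  differentials of the competing functions. Hence its norm obeys their common bound however
  many of them overlap, which a partition of unity would not achieve.
\<close>

section \<open>Functions of class \<open>C\<^sup>1\<close>\<close>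

text \<open>The clause for \<open>k = 0\<close> makes \<open>D 1 x\<close> the derivative. The
  clause for \<open>k = 1\<close>, combined with a bound for \<open>D 2 x\<close>, shows that the
  derivative is Lipschitz at every point in operator norm, hence continuous.\<close>

lemma smooth_on_imp_C1_on:
  fixes f :: "'a::real_normed_vector \<Rightarrow> 'b::real_normed_vector"
  assumes U: "open U" and f: "smooth_on U f"
  shows "C1_on U f"
proof -
  obtain D :: "nat \<Rightarrow> 'a \<Rightarrow> 'a list \<Rightarrow> 'b" where D: "\<forall>x\<in>U. D 0 x [] = f x \<and>
        (\<forall>k. bounded_multilinear k (D k x)) \<and>
        (\<forall>k. \<forall>e>0. \<forall>\<^sub>F y in at x. \<forall>vs. length vs = k \<longrightarrow>
           norm (D k y vs - D k x vs - D (Suc k) x ((y - x) # vs))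
             \<le> e * norm (y - x) * prod_list (map norm vs))"
    using f unfolding smooth_on_def by blast
  have D0: "D 0 x [] = f x" and mult: "bounded_multilinear k (D k x)" if "x \<in> U" for x k
    using D that by auto
  have der: "\<forall>\<^sub>F y in at x. \<forall>vs. length vs = k \<longrightarrow>
           norm (D k y vs - D k x vs - D (Suc k) x ((y - x) # vs))
             \<le> e * norm (y - x) * prod_list (map norm vs)" if "x \<in> U" "e > 0" for x k e
    using D that by blast
  have bl: "bounded_linear (\<lambda>v. D 1 x [v])" if x: "x \<in> U" for x
  proof -
    obtain K where K: "\<And>vs. length vs = 1 \<Longrightarrow> norm (D 1 x vs) \<le> K * prod_list (map norm vs)"
      using mult[OF x, of 1] unfolding bounded_multilinear_def by auto
    have lin: "linear (\<lambda>v. D 1 x ([0][0 := v]))"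
      using mult[OF x, of 1] unfolding bounded_multilinear_def by (metis One_nat_def length_Cons less_one list.size(3))
    show ?thesis
    proof (intro bounded_linear_intro[of _ K])
      show "norm (D 1 x [v]) \<le> norm v * K" for v
        using K[of "[v]"] by (simp add: mult.commute)
    qed (use linear_add[OF lin] linear_cmul[OF lin] in auto)
  qed
  define f' where "f' x = Blinfun (\<lambda>v. D 1 x [v])" for x
  have f': "blinfun_apply (f' x) v = D 1 x [v]" if "x \<in> U" for x v
    using bl[OF that] by (simp add: f'_def bounded_linear_Blinfun_apply)
  have "(f has_derivative blinfun_apply (f' x)) (at x)" if x: "x \<in> U" for x
    unfolding has_derivative_at_alt
  proof (intro conjI allI impI)
    fix e :: real assume "0 < e"
    from der[OF x this, of 0] have "\<forall>\<^sub>F y in at x. norm (D 0 y [] - D 0 x [] - D 1 x [y - x]) \<le> e * norm (y - x)"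
      by simp
    moreover have "\<forall>\<^sub>F y in at x. y \<in> U"
      using U x by (simp add: eventually_at_in_open')
    ultimately have "\<forall>\<^sub>F y in at x. norm (f y - f x - f' x (y - x)) \<le> e * norm (y - x)"
      by eventually_elim (use x in \<open>simp add: D0 f'\<close>)
    then obtain d where "d > 0" and d: "\<And>y. y \<noteq> x \<Longrightarrow> dist y x < d \<Longrightarrow> norm (f y - f x - f' x (y - x)) \<le> e * norm (y - x)"
      unfolding eventually_at by auto
    show "\<exists>d>0. \<forall>y. norm (y - x) < d \<longrightarrow> norm (f y - f x - f' x (y - x)) \<le> e * norm (y - x)"
    proof (intro exI[of _ d] conjI allI impI)
      fix y assume "norm (y - x) < d"
      then show "norm (f y - f x - f' x (y - x)) \<le> e * norm (y - x)"
        using d[of y] by (cases "y = x") (auto simp: dist_norm)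
    qed fact
  qed (simp add: blinfun.bounded_linear_right)
  moreover have "continuous_on U f'"
    unfolding continuous_on_eq_continuous_at[OF U]
  proof
    fix x assume x: "x \<in> U"
    obtain K where K: "\<And>vs. length vs = 2 \<Longrightarrow> norm (D 2 x vs) \<le> K * prod_list (map norm vs)"
      using mult[OF x, of 2] unfolding bounded_multilinear_def by auto
    have "\<forall>\<^sub>F y in at x. \<forall>vs. length vs = 1 \<longrightarrow>
           norm (D 1 y vs - D 1 x vs - D 2 x ((y - x) # vs)) \<le> 1 * norm (y - x) * prod_list (map norm vs)"
      using der[OF x zero_less_one, of 1] by (simp add: numeral_2_eq_2)
    moreover have "\<forall>\<^sub>F y in at x. y \<in> U"
      using U x by (simp add: eventually_at_in_open')
    ultimately have "\<forall>\<^sub>F y in at x. norm (f' y - f' x) \<le> (1 + \<bar>K\<bar>) * norm (y - x)"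
    proof eventually_elim
      case (elim y)
      show ?case
      proof (intro norm_blinfun_bound)
        fix v
        have "norm (D 1 y [v] - D 1 x [v] - D 2 x [y - x, v]) \<le> norm (y - x) * norm v"
          using elim(1) by (auto dest: spec[of _ "[v]"])
        moreover have "norm (D 2 x [y - x, v]) \<le> K * (norm (y - x) * norm v)"
          using K[of "[y - x, v]"] by simp
        moreover have "K * (norm (y - x) * norm v) \<le> \<bar>K\<bar> * (norm (y - x) * norm v)"
          by (intro mult_right_mono) auto
        moreover have "norm (D 1 y [v] - D 1 x [v]) \<le> norm (D 1 y [v] - D 1 x [v] - D 2 x [y - x, v]) + norm (D 2 x [y - x, v])"
          by (metis diff_add_cancel norm_triangle_ineq)
        ultimately show "norm ((f' y - f' x) v) \<le> (1 + \<bar>K\<bar>) * norm (y - x) * norm v"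
          using elim x by (simp add: blinfun.diff_left f' algebra_simps)
      qed auto
    qed
    moreover have "((\<lambda>y. (1 + \<bar>K\<bar>) * norm (y - x)) \<longlongrightarrow> (1 + \<bar>K\<bar>) * norm (x - x)) (at x)"
      by (intro tendsto_intros)
    then have "((\<lambda>y. (1 + \<bar>K\<bar>) * norm (y - x)) \<longlongrightarrow> 0) (at x)"
      by simp
    ultimately have "((\<lambda>y. f' y - f' x) \<longlongrightarrow> 0) (at x)"
      by (rule Lim_null_comparison)
    then show "isCont f' x"
      unfolding isCont_def using LIM_zero_cancel by blast
  qed
  ultimately show ?thesis
    unfolding C1_on_def by blast
qed

lemma C1_on_imp_continuous_on: "C1_on U f \<Longrightarrow> continuous_on U f"
  unfolding C1_on_def
  by (meson continuous_at_imp_continuous_on has_derivative_continuous)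

lemma C1_on_subset: "C1_on U f \<Longrightarrow> V \<subseteq> U \<Longrightarrow> C1_on V f"
  unfolding C1_on_def by (meson continuous_on_subset subsetD)

lemma C1_on_derivative:
  assumes "C1_on U f" "x \<in> U"
  shows "(f has_derivative frechet_derivative f (at x)) (at x)"
  using assms unfolding C1_on_def
  by (metis differentiableI frechet_derivative_works)

text \<open>Derivatives at a point of the whole space are unique, so the existential witness in
  \<open>C1_on\<close> can be replaced by a canonical one. Being C^1 then becomes a pointwise
  condition, and local pieces glue without any matching of witnesses.\<close>

lemma C1_on_iff_frechet:
  "C1_on U f \<longleftrightarrow> (\<forall>x\<in>U. f differentiable at x) \<and>
    continuous_on U (\<lambda>x. Blinfun (frechet_derivative f (at x)))"
proof
  assume "C1_on U f"
  then obtain f' where c: "continuous_on U f'" and d: "\<And>x. x \<in> U \<Longrightarrow> (f has_derivative blinfun_apply (f' x)) (at x)"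
    unfolding C1_on_def by blast
  have "Blinfun (frechet_derivative f (at x)) = f' x" if "x \<in> U" for x
    using frechet_derivative_at[OF d[OF that]] by (metis blinfun_apply_inverse)
  then show "(\<forall>x\<in>U. f differentiable at x) \<and>
    continuous_on U (\<lambda>x. Blinfun (frechet_derivative f (at x)))"
    using c d by (auto simp: differentiable_def cong: continuous_on_cong)
next
  assume a: "(\<forall>x\<in>U. f differentiable at x) \<and>
    continuous_on U (\<lambda>x. Blinfun (frechet_derivative f (at x)))"
  then show "C1_on U f"
    unfolding C1_on_def
    by (intro exI[of _ "\<lambda>x. Blinfun (frechet_derivative f (at x))"])
      (metis bounded_linear_Blinfun_apply frechet_derivative_works has_derivative_bounded_linear)
qed

lemma C1_on_local:
  assumes "\<And>x. x \<in> U \<Longrightarrow> \<exists>W. open W \<and> x \<in> W \<and> C1_on W f"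
  shows "C1_on U f"
  unfolding C1_on_iff_frechet
proof (intro conjI ballI)
  show "f differentiable at x" if "x \<in> U" for x
    using assms[OF that] by (auto simp: C1_on_iff_frechet)
  show "continuous_on U (\<lambda>x. Blinfun (frechet_derivative f (at x)))"
    using assms by (intro continuous_at_imp_continuous_on)
      (metis C1_on_iff_frechet continuous_on_eq_continuous_at)
qed

lemma C1_on_cong:
  assumes "open U" "C1_on U f" "\<And>x. x \<in> U \<Longrightarrow> f x = g x"
  shows "C1_on U g"
proof -
  obtain f' where "continuous_on U f'" "\<And>x. x \<in> U \<Longrightarrow> (f has_derivative blinfun_apply (f' x)) (at x)"
    using assms(2) unfolding C1_on_def by blast
  then show ?thesis
    unfolding C1_on_def using assms(1,3) by (metis has_derivative_transform_within_open)
qed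

lemma C1_on_compose:
  assumes f: "C1_on U f" and g: "C1_on V g" and "f ` U \<subseteq> V"
  shows "C1_on U (g \<circ> f)"
proof -
  obtain f' where f': "continuous_on U f'" "\<And>x. x \<in> U \<Longrightarrow> (f has_derivative blinfun_apply (f' x)) (at x)"
    using f unfolding C1_on_def by blast
  obtain g' where g': "continuous_on V g'" "\<And>x. x \<in> V \<Longrightarrow> (g has_derivative blinfun_apply (g' x)) (at x)"
    using g unfolding C1_on_def by blast
  show ?thesis unfolding C1_on_def
  proof (intro exI[of _ "\<lambda>x. g' (f x) o\<^sub>L f' x"] conjI ballI)
    show "continuous_on U (\<lambda>x. g' (f x) o\<^sub>L f' x)"
      by (intro continuous_intros f' continuous_on_compose2[OF g'(1)] C1_on_imp_continuous_on f assms(3))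
    show "((g \<circ> f) has_derivative blinfun_apply (g' (f x) o\<^sub>L f' x)) (at x)" if "x \<in> U" for x
      using diff_chain_at[OF f'(2)[OF that] g'(2)[of "f x"]] assms(3) that
      by (auto simp: blinfun_compose.rep_eq)
  qed
qed

lemma C1_on_real:
  fixes f :: "real \<Rightarrow> real"
  assumes "\<And>x. (f has_real_derivative f' x) (at x)" "continuous_on UNIV f'"
  shows "C1_on UNIV f"
  unfolding C1_on_def
proof (intro exI[of _ "\<lambda>x. blinfun_scaleR_left (f' x)"] conjI ballI)
  show "continuous_on UNIV (\<lambda>x. blinfun_scaleR_left (f' x) :: real \<Rightarrow>\<^sub>L real)"
    by (intro bounded_linear.continuous_on[OF bounded_linear_blinfun_scaleR_left] assms)
  show "(f has_derivative blinfun_apply (blinfun_scaleR_left (f' x))) (at x)" for x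
    using assms(1)[of x] by (simp add: has_field_derivative_def blinfun_scaleR_left.rep_eq mult_commute_abs)
qed

section \<open>Lasry-Lions regularization\<close>

text \<open>The common source of differentiability for the regularized function, for
  \<open>possq\<close> and for the smoothed maximum: each time a remainder is shown to be of second
  order. The filter \<open>nhds x\<close> contains the point itself, which forces
  \<open>f x = 0\<close>.\<close>

lemma has_derivative_zero_of_quadratic_bound:
  fixes f :: "'a::real_normed_vector \<Rightarrow> real"
  assumes bound: "\<forall>\<^sub>F y in nhds x. \<bar>f y\<bar> \<le> K * (norm (y - x))\<^sup>2"
  shows "(f has_derivative (\<lambda>_. 0)) (at x)"
proof -
  have "\<bar>f y\<bar> / norm (y - x) \<le> \<bar>K\<bar> * norm (y - x)" if "\<bar>f y\<bar> \<le> K * (norm (y - x))\<^sup>2" for y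
  proof -
    have "\<bar>f y\<bar> \<le> (\<bar>K\<bar> * norm (y - x)) * norm (y - x)"
      using that mult_right_mono[OF abs_ge_self[of K], of "(norm (y - x))\<^sup>2"]
      by (simp add: power2_eq_square mult_ac)
    then show ?thesis
      by (cases "y = x") (auto simp: pos_divide_le_eq)
  qed
  then have "\<forall>\<^sub>F y in at x. norm (\<bar>f y\<bar> / norm (y - x)) \<le> \<bar>K\<bar> * norm (y - x)"
    unfolding eventually_at_filter by (intro eventually_mono[OF bound]) simp
  moreover have "((\<lambda>y. \<bar>K\<bar> * norm (y - x)) \<longlongrightarrow> 0) (at x)"
    by (intro tendsto_mult_right_zero tendsto_norm_zero LIM_zero tendsto_ident_at)
  ultimately have "((\<lambda>y. \<bar>f y\<bar> / norm (y - x)) \<longlongrightarrow> 0) (at x)"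
    by (rule Lim_null_comparison)
  moreover have "f x = 0"
    using eventually_nhds_x_imp_x[OF bound] by simp
  ultimately show ?thesis
    by (simp add: has_derivative_iff_norm)
qed

text \<open>An inner product whose norm \<open>N\<close> is equivalent to the given one. It will be
  the Riemannian metric frozen at a point of a chart, which need not be the inner product of the
  model space.\<close>

locale equivalent_inner =
  fixes B :: "'e::banach \<Rightarrow> 'e \<Rightarrow> real"
  assumes bilinear: "bounded_bilinear B"
    and sym: "B u v = B v u"
    and coercive: "\<exists>c>0. \<forall>v. c * (norm v)\<^sup>2 \<le> B v v"
begin

sublocale bounded_bilinear B
  by (rule bilinear)

definition N :: "'e \<Rightarrow> real" where
  "N v = sqrt (B v v)"

lemma B_self_nonneg: "0 \<le> B v v"
proof -
  obtain c where "c > 0" "c * (norm v)\<^sup>2 \<le> B v v"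
    using coercive by blast
  moreover from this have "0 \<le> c * (norm v)\<^sup>2" by simp
  ultimately show ?thesis by linarith
qed

lemma N_nonneg [simp]: "0 \<le> N v"
  by (simp add: N_def B_self_nonneg)

lemma N_square: "(N v)\<^sup>2 = B v v"
  by (simp add: N_def B_self_nonneg)

lemma N_zero [simp]: "N 0 = 0"
  by (simp add: N_def zero_left)

lemma N_minus_commute: "N (u - v) = N (v - u)"
  by (simp add: N_def diff_left diff_right)

lemma N_bounds: "\<exists>c>0. \<exists>K>0. \<forall>v. c * norm v \<le> N v \<and> N v \<le> K * norm v"
proof -
  obtain c where c: "c > 0" "\<And>v. c * (norm v)\<^sup>2 \<le> B v v"
    using coercive by blast
  obtain K where K: "K > 0" "\<And>u v. norm (B u v) \<le> norm u * norm v * K"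
    using pos_bounded by blast
  have "sqrt c * norm v \<le> N v" for v
    using real_sqrt_le_mono[OF c(2)[of v]] by (simp add: N_def real_sqrt_mult)
  moreover have "N v \<le> sqrt K * norm v" for v
  proof -
    have "B v v \<le> K * (norm v)\<^sup>2"
      using K(2)[of v v] by (simp add: power2_eq_square mult_ac)
    from real_sqrt_le_mono[OF this] show ?thesis
      by (simp add: N_def real_sqrt_mult)
  qed
  ultimately show ?thesis
    using c(1) K(1) by (intro exI[of _ "sqrt c"] conjI exI[of _ "sqrt K"]) auto
qed

lemma N_eq_0_iff: "N v = 0 \<longleftrightarrow> v = 0"
proof
  assume "N v = 0"
  moreover obtain c where "c > 0" "c * norm v \<le> N v"
    using N_bounds by blast
  ultimately have "norm v \<le> 0"
    by (simp add: mult_le_0_iff)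
  then show "v = 0" by simp
qed simp

lemma B_Cauchy_Schwarz: "B u v \<le> N u * N v"
proof (cases "N u = 0 \<or> N v = 0")
  case True
  then show ?thesis
    by (auto simp: N_eq_0_iff zero_left zero_right)
next
  case False
  then have pos: "0 < N u * N v"
    by (simp add: less_le)
  have "0 \<le> B (N v *\<^sub>R u - N u *\<^sub>R v) (N v *\<^sub>R u - N u *\<^sub>R v)"
    by (rule B_self_nonneg)
  also have "\<dots> = (N v)\<^sup>2 * B u u - 2 * N u * N v * B u v + (N u)\<^sup>2 * B v v"
    by (simp add: diff_left diff_right scaleR_left scaleR_right sym[of v u] power2_eq_square algebra_simps)
  also have "\<dots> = 2 * (N u * N v) * (N u * N v - B u v)"
    by (simp add: N_square[symmetric] power2_eq_square algebra_simps)
  finally show ?thesis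
    using pos by (simp add: zero_le_mult_iff)
qed

lemma B_abs_le: "\<bar>B u v\<bar> \<le> N u * N v"
  using B_Cauchy_Schwarz[of u v] B_Cauchy_Schwarz[of "- u" v]
  by (simp add: N_def minus_left minus_right abs_le_iff)

lemma N_triangle: "N (u + v) \<le> N u + N v"
proof (rule power2_le_imp_le)
  show "(N (u + v))\<^sup>2 \<le> (N u + N v)\<^sup>2"
    using B_Cauchy_Schwarz[of u v]
    by (simp add: N_square power2_sum add_left add_right sym[of v u])
qed simp

lemma N_triangle_minus: "N (x - z) \<le> N (x - y) + N (y - z)"
  using N_triangle[of "x - y" "y - z"] by simp

lemma N_scale: "N (t *\<^sub>R v) = \<bar>t\<bar> * N v"
  by (simp add: N_def scaleR_left scaleR_right real_sqrt_mult flip: mult.assoc)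

lemma B_diff_self: "B (u - v) (u - v) = B u u - 2 * B u v + B v v"
  by (simp add: diff_left diff_right sym[of v u])

text \<open>The parallelogram law, and the point where the Hilbert structure is decisive: the
  midpoint defect of the square of \<open>N\<close> is an exact constant multiple of
  \<open>B (u - v) (u - v)\<close>, independent of \<open>y\<close>. Thus semiconcavity and strong
  concavity can be compared constant by constant.\<close>

lemma parallelogram_midpoint:
  "B (y - (1/2) *\<^sub>R (u + v)) (y - (1/2) *\<^sub>R (u + v)) =
    (B (y - u) (y - u) + B (y - v) (y - v)) / 2 - B (u - v) (u - v) / 4"
  by (simp add: diff_left diff_right add_left add_right scaleR_left scaleR_right
      sym[of u y] sym[of v y] sym[of v u] field_simps)

text \<open>
  The inf-convolution with \<open>M N\<^sup>2\<close> makes the function semiconcave; the sup-convolution with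
  \<open>2 M N\<^sup>2\<close> then has a strongly concave objective, so its maximizer exists, is unique
  and depends on the point in a Lipschitz way, and it determines the gradient (Lasry and Lions).
\<close>

proposition Lasry_Lions_regularization:
  fixes U :: "'e \<Rightarrow> real"
  assumes L: "\<And>x y. U x - U y \<le> L * N (x - y)" and "0 < L" and "0 < \<eta>"
  obtains k where "C1_on UNIV k" "\<And>x y. k x - k y \<le> L * N (x - y)"
    "\<And>x. U x - \<eta> \<le> k x" "\<And>x. k x \<le> U x + \<eta>"
proof -
  \<comment> \<open>The maximum of \<open>L * r - M * r\<^sup>2\<close> over \<open>r\<close> is
    then exactly \<open>\<eta>\<close>, so that replacing \<open>U\<close> by its convolutions costs
    at most \<open>\<eta>\<close> on either side.\<close>
  define M where "M = L\<^sup>2 / (4 * \<eta>)"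
  have M: "M > 0"
    using assms by (simp add: M_def)
  have quad: "L * r \<le> M * r\<^sup>2 + \<eta>" for r
  proof -
    have "0 \<le> (L * r - 2 * \<eta>)\<^sup>2" by simp
    then have "4 * \<eta> * (L * r) \<le> 4 * \<eta> * (M * r\<^sup>2 + \<eta>)"
      using \<open>0 < \<eta>\<close> by (simp add: M_def power2_eq_square algebra_simps)
    then show ?thesis
      using \<open>0 < \<eta>\<close> by simp
  qed
  define Q where "Q v = B v v" for v
  have Q: "Q v = (N v)\<^sup>2" "0 \<le> Q v" for v
    by (simp_all add: Q_def N_square B_self_nonneg)
  have Q_mid: "Q (y - (1/2) *\<^sub>R (u + v)) = (Q (y - u) + Q (y - v)) / 2 - Q (u - v) / 4" for y u v
    unfolding Q_def by (rule parallelogram_midpoint)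

  define w where "w z = (INF a. U a + M * Q (z - a))" for z
  have w_lower: "U z - \<eta> \<le> U a + M * Q (z - a)" for z a
    using L[of z a] quad[of "N (z - a)"] by (simp add: Q(1))
  have w_bdd: "bdd_below (range (\<lambda>a. U a + M * Q (z - a)))" for z
    using w_lower by (intro bdd_belowI2[where m = "U z - \<eta>"])
  have w_le: "w z \<le> U a + M * Q (z - a)" for z a
    unfolding w_def by (rule cINF_lower[OF w_bdd]) simp
  have w_ge: "c \<le> w z" if "\<And>a. c \<le> U a + M * Q (z - a)" for c z
    unfolding w_def using that by (intro cINF_greatest) auto
  have w_U: "U z - \<eta> \<le> w z" "w z \<le> U z" for z
    using w_ge[OF w_lower, of z] w_le[of z z] by (auto simp: Q_def zero_left)
  \<comment> \<open>Translation: a competitor \<open>a\<close> for \<open>y\<close> becomes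
    \<open>a + (x - y)\<close> for \<open>x\<close>, which leaves the quadratic term unchanged. The
    same shift gives the Lipschitz bound for \<open>k\<close> at the end.\<close>
  have w_L: "w x - w y \<le> L * N (x - y)" for x y
  proof -
    have "w x - L * N (x - y) \<le> U a + M * Q (y - a)" for a
      using w_le[of x "a + (x - y)"] L[of "a + (x - y)" a] by (simp add: algebra_simps)
    from w_ge[OF this] show ?thesis by simp
  qed
  \<comment> \<open>Semiconcavity of \<open>w\<close>: for each fixed \<open>a\<close> the
    parallelogram identity gives the estimate with a defect that does not depend on
    \<open>a\<close>, and an infimum preserves it.\<close>
  have w_mid: "(w u + w v) / 2 - M / 4 * Q (u - v) \<le> w ((1/2) *\<^sub>R (u + v))" for u v
  proof (rule w_ge)
    fix a
    have mid: "Q ((1/2) *\<^sub>R (u + v) - a) = (Q (u - a) + Q (v - a)) / 2 - Q (u - v) / 4"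
      using Q_mid[of a u v] by (simp add: Q(1) N_minus_commute[of a])
    show "(w u + w v) / 2 - M / 4 * Q (u - v) \<le> U a + M * Q ((1/2) *\<^sub>R (u + v) - a)"
      unfolding mid using w_le[of u a] w_le[of v a] by (simp add: field_simps)
  qed

  define \<Phi> where "\<Phi> x z = w z - 2 * M * Q (x - z)" for x z
  define k where "k x = (SUP z. \<Phi> x z)" for x
  have \<Phi>_upper: "\<Phi> x z \<le> U x + \<eta>" for x z
  proof -
    have "w z \<le> U x + (M * Q (x - z) + \<eta>)"
      using w_U(2)[of z] L[of z x] quad[of "N (x - z)"]
      by (simp add: Q(1) N_minus_commute[of z])
    moreover have "0 \<le> M * Q (x - z)"
      using M Q(2) by simp
    ultimately show ?thesis
      unfolding \<Phi>_def by linarith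
  qed
  have bdd: "bdd_above (range (\<Phi> x))" for x
    using \<Phi>_upper by (intro bdd_aboveI2[where M = "U x + \<eta>"])
  have k_ge: "\<Phi> x z \<le> k x" for x z
    unfolding k_def by (rule cSUP_upper[OF _ bdd]) simp
  have k_le: "k x \<le> c" if "\<And>z. \<Phi> x z \<le> c" for c x
    unfolding k_def using that by (intro cSUP_least) auto
  \<comment> \<open>The penalty with constant \<open>2 * M\<close> gains
    \<open>M / 2 * Q (u - v)\<close> at a midpoint, while \<open>w\<close> loses at most
    \<open>M / 4 * Q (u - v)\<close>. The difference is the strong concavity.\<close>
  have \<Phi>_mid: "(\<Phi> x u + \<Phi> x v) / 2 + M / 4 * Q (u - v) \<le> \<Phi> x ((1/2) *\<^sub>R (u + v))" for x u v
    using w_mid[of u v] unfolding \<Phi>_def Q_mid[of x u v] by (simp add: field_simps)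
  \<comment> \<open>Near-maximizers are close to each other. This one estimate yields both the
    existence of a maximizer and its Lipschitz dependence on \<open>x\<close>.\<close>
  have gap: "M / 2 * Q (u - v) \<le> 2 * k x - \<Phi> x u - \<Phi> x v" for x u v
    using \<Phi>_mid[of x u v] k_ge[of x "(1/2) *\<^sub>R (u + v)"] by (simp add: field_simps)

  obtain c K where c: "c > 0" "\<And>v. c * norm v \<le> N v" and K: "K > 0" "\<And>v. N v \<le> K * norm v"
    using N_bounds by metis

  \<comment> \<open>Completeness takes the place of compactness: by \<open>gap\<close> a maximizing
    sequence is Cauchy, and continuity of \<open>\<Phi> x\<close> shows that its limit attains the
    supremum.\<close>
  have "\<exists>z. \<Phi> x z = k x" for x
  proof -
    have "\<exists>z. k x - 1 / Suc n < \<Phi> x z" for n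
      unfolding k_def using less_cSUP_iff[OF _ bdd, of "k x - 1 / Suc n" x] by (simp add: k_def)
    then obtain z where z: "\<And>n. k x - 1 / Suc n < \<Phi> x (z n)"
      by metis
    have z_dist: "M / 2 * c\<^sup>2 * (norm (z m - z n))\<^sup>2 \<le> 1 / Suc m + 1 / Suc n" for m n
    proof -
      have "(c * norm (z m - z n))\<^sup>2 \<le> (N (z m - z n))\<^sup>2"
        using c by (intro power_mono) auto
      then have "M / 2 * (c * norm (z m - z n))\<^sup>2 \<le> M / 2 * Q (z m - z n)"
        unfolding Q(1) using M by (intro mult_left_mono) auto
      then show ?thesis
        using gap[of "z m" "z n" x] z[of m] z[of n] by (simp add: power_mult_distrib)
    qed
    have "Cauchy z"
    proof (rule metric_CauchyI)
      fix e :: real assume "0 < e"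
      define C where "C = M / 2 * c\<^sup>2"
      have "C > 0"
        using M c by (simp add: C_def)
      have "(\<lambda>n. 1 / real (Suc n)) \<longlonglongrightarrow> 0"
        using LIMSEQ_inverse_real_of_nat by (simp add: inverse_eq_divide)
      then obtain n0 where n0: "\<And>n. n \<ge> n0 \<Longrightarrow> 1 / Suc n < C * e\<^sup>2 / 2"
        using order_tendstoD(2)[of _ 0 sequentially "C * e\<^sup>2 / 2"] \<open>C > 0\<close> \<open>0 < e\<close>
        unfolding eventually_sequentially by (metis divide_pos_pos mult_pos_pos zero_less_numeral zero_less_power)
      have "dist (z m) (z n) < e" if "m \<ge> n0" "n \<ge> n0" for m n
      proof -
        have "C * (norm (z m - z n))\<^sup>2 < C * e\<^sup>2"
          using z_dist[of m n] n0[OF that(1)] n0[OF that(2)] unfolding C_def by linarith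
        then have "(norm (z m - z n))\<^sup>2 < e\<^sup>2"
          using \<open>C > 0\<close> by simp
        then show ?thesis
          using \<open>0 < e\<close> by (simp add: dist_norm power_less_imp_less_base)
      qed
      then show "\<exists>n0. \<forall>m\<ge>n0. \<forall>n\<ge>n0. dist (z m) (z n) < e"
        by blast
    qed
    then obtain l where l: "z \<longlonglongrightarrow> l"
      using Cauchy_convergent_iff convergent_def by blast
    have "(\<lambda>n. w (z n)) \<longlonglongrightarrow> w l"
    proof (rule LIM_zero_cancel, rule Lim_null_comparison)
      show "\<forall>\<^sub>F n in sequentially. norm (w (z n) - w l) \<le> L * K * norm (z n - l)"
      proof (intro always_eventually allI)
        fix n
        have "\<bar>w (z n) - w l\<bar> \<le> L * N (z n - l)"
          using w_L[of "z n" l] w_L[of l "z n"] by (simp add: N_minus_commute[of l])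
        also have "\<dots> \<le> L * (K * norm (z n - l))"
          using K \<open>0 < L\<close> by (intro mult_left_mono) auto
        finally show "norm (w (z n) - w l) \<le> L * K * norm (z n - l)"
          by simp
      qed
      show "(\<lambda>n. L * K * norm (z n - l)) \<longlonglongrightarrow> 0"
        using l by (intro tendsto_mult_right_zero tendsto_norm_zero LIM_zero)
    qed
    then have "(\<lambda>n. \<Phi> x (z n)) \<longlonglongrightarrow> \<Phi> x l"
      unfolding \<Phi>_def Q_def by (intro tendsto_intros tendsto l)
    moreover have "(\<lambda>n. k x - 1 / Suc n) \<longlonglongrightarrow> k x - 0"
      using LIMSEQ_inverse_real_of_nat by (intro tendsto_intros) (simp add: inverse_eq_divide)
    ultimately have "k x - 0 \<le> \<Phi> x l"
      using z by (intro LIMSEQ_le[where X = "\<lambda>n. k x - 1 / Suc n"]) (auto intro: less_imp_le)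
    then show ?thesis
      using k_ge[of x l] by (intro exI[of _ l]) simp
  qed
  then obtain Z where Z: "\<And>x. \<Phi> x (Z x) = k x"
    by metis

  \<comment> \<open>Add \<open>gap\<close> at \<open>x\<close> and at \<open>y\<close>, both for the
    pair of maximizers. All values of \<open>w\<close> and all pure squares cancel, and only
    \<open>4 * M * B (x - y) (Z x - Z y)\<close> remains.\<close>
  have Z_L: "N (Z x - Z y) \<le> 4 * N (x - y)" for x y
  proof -
    have "M / 2 * Q (Z x - Z y) \<le> \<Phi> x (Z x) - \<Phi> x (Z y)"
      using gap[of "Z x" "Z y" x] Z[of x] by simp
    moreover have "M / 2 * Q (Z x - Z y) \<le> \<Phi> y (Z y) - \<Phi> y (Z x)"
      using gap[of "Z x" "Z y" y] Z[of y] by simp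
    moreover have "Q (u - v) = B u u - 2 * B u v + B v v" for u v
      unfolding Q_def by (rule B_diff_self)
    note this[of x "Z x"] this[of x "Z y"] this[of y "Z x"] this[of y "Z y"]
    moreover have "4 * M * B (x - y) (Z x - Z y) = 4 * M * (B x (Z x) - B x (Z y) - B y (Z x) + B y (Z y))"
      by (simp add: diff_left diff_right)
    ultimately have "M * Q (Z x - Z y) \<le> 4 * M * B (x - y) (Z x - Z y)"
      unfolding \<Phi>_def by (simp add: algebra_simps)
    also have "\<dots> \<le> 4 * M * (N (x - y) * N (Z x - Z y))"
      using M B_Cauchy_Schwarz by (intro mult_left_mono) auto
    finally have "N (Z x - Z y) * N (Z x - Z y) \<le> 4 * N (x - y) * N (Z x - Z y)"
      using M by (simp add: Q(1) power2_eq_square)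
    then show ?thesis
      by (cases "N (Z x - Z y) = 0") (simp_all add: mult_le_cancel_right less_le)
  qed

  \<comment> \<open>Envelope principle: the derivative of \<open>k\<close> at \<open>x\<close> is
    that of the penalty \<open>- 2 * M * Q (x - z)\<close> with \<open>z\<close> frozen at the
    maximizer \<open>Z x\<close>.\<close>
  define k' where "k' x = Blinfun (\<lambda>h. - 4 * M * B (x - Z x) h)" for x
  have k': "blinfun_apply (k' x) h = - 4 * M * B (x - Z x) h" for x h
    unfolding k'_def
    by (intro bounded_linear_Blinfun_apply[THEN fun_cong] bounded_linear_const_mult bounded_linear_right)
  have expand_lower: "k x - 4 * M * B (x - Z x) (y - x) - 2 * M * Q (y - x) \<le> k y" for x y
  proof -
    have "Q (y - Z x) = Q (x - Z x) + 2 * B (x - Z x) (y - x) + Q (y - x)"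
      unfolding Q_def B_diff_self
      by (simp add: diff_left diff_right sym[of "Z x" x] sym[of "Z x" y] sym[of y x])
    then show ?thesis
      using k_ge[of y "Z x"] Z[of x] unfolding \<Phi>_def by (simp add: algebra_simps)
  qed
  \<comment> \<open>Testing the supremum at \<open>y\<close> with \<open>Z x\<close> gives the lower
    bound, with error \<open>2 * M * Q (y - x)\<close>. Exchanging \<open>x\<close> and
    \<open>y\<close> gives the upper bound with the gradient at \<open>y\<close>; by
    \<open>Z_L\<close> changing the gradient costs \<open>4 * 5 * M * Q (y - x)\<close>.\<close>
  have remainder: "\<bar>k y - k x - k' x (y - x)\<bar> \<le> 22 * M * Q (y - x)" for x y
  proof -
    have "- B (y - x - (Z y - Z x)) (y - x) \<le> N (y - x - (Z y - Z x)) * N (y - x)"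
      using B_abs_le[of "y - x - (Z y - Z x)" "y - x"] by linarith
    also have "\<dots> \<le> (5 * N (y - x)) * N (y - x)"
      using N_triangle_minus[of "y - x" "Z y - Z x" 0] Z_L[of y x] N_minus_commute[of 0 "Z y - Z x"]
      by (intro mult_right_mono) auto
    finally have "M * - B (y - x - (Z y - Z x)) (y - x) \<le> M * (5 * Q (y - x))"
      using M by (intro mult_left_mono) (auto simp: Q(1) power2_eq_square)
    moreover have "M * - B (y - x - (Z y - Z x)) (y - x) = M * B (x - Z x) (y - x) - M * B (y - Z y) (y - x)"
      unfolding diff_left by (simp add: right_diff_distrib)
    moreover have "k y + 4 * M * B (y - Z y) (y - x) - 2 * M * Q (y - x) \<le> k x"
    proof -
      have "B (y - Z y) (x - y) = - B (y - Z y) (y - x)"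
        by (simp add: diff_right)
      moreover have "Q (x - y) = Q (y - x)"
        by (simp add: Q(1) N_minus_commute)
      ultimately show ?thesis
        using expand_lower[of y x] by simp
    qed
    moreover have "0 \<le> M * Q (y - x)"
      using M Q(2) by simp
    ultimately show ?thesis
      using expand_lower[of x y] unfolding k' abs_le_iff by (intro conjI; linarith)
  qed
  have "C1_on UNIV k"
    unfolding C1_on_def
  proof (intro exI[of _ k'] conjI ballI)
    fix x
    have small: "((\<lambda>y. k y - k x - k' x (y - x)) has_derivative (\<lambda>_. 0)) (at x)"
    proof (rule has_derivative_zero_of_quadratic_bound, rule always_eventually, rule allI)
      show "\<bar>k y - k x - k' x (y - x)\<bar> \<le> 22 * M * K\<^sup>2 * (norm (y - x))\<^sup>2" for y
      proof -
        have "Q (y - x) \<le> (K * norm (y - x))\<^sup>2"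
          unfolding Q(1) using K by (intro power_mono) auto
        then have "22 * M * Q (y - x) \<le> 22 * M * (K * norm (y - x))\<^sup>2"
          using M by (intro mult_left_mono) auto
        then show ?thesis
          using remainder[of y x] by (simp add: power_mult_distrib)
      qed
    qed
    have affine: "((\<lambda>y. k x + k' x (y - x)) has_derivative k' x) (at x)"
      by (auto intro!: derivative_eq_intros simp: blinfun.zero_right)
    show "(k has_derivative blinfun_apply (k' x)) (at x)"
      using has_derivative_add[OF small affine] by simp
  next
    show "continuous_on UNIV k'"
      unfolding continuous_on_def
    proof (intro ballI)
      fix x
      have bound: "norm (k' y - k' x) \<le> 20 * M * K\<^sup>2 * norm (y - x)" for y
      proof (rule norm_blinfun_bound)
        fix h
        have "\<bar>B ((y - x) - (Z y - Z x)) h\<bar> \<le> N ((y - x) - (Z y - Z x)) * N h"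
          by (rule B_abs_le)
        also have "\<dots> \<le> (5 * N (y - x)) * N h"
          using N_triangle_minus[of "y - x" "Z y - Z x" 0] Z_L[of y x] N_minus_commute[of 0 "Z y - Z x"]
          by (intro mult_right_mono) auto
        also have "\<dots> \<le> (5 * (K * norm (y - x))) * (K * norm h)"
          using K by (intro mult_mono) auto
        finally have "4 * M * \<bar>B ((y - x) - (Z y - Z x)) h\<bar> \<le> 4 * M * (5 * (K * norm (y - x)) * (K * norm h))"
          using M by (intro mult_left_mono) auto
        moreover have "(k' y - k' x) h = - (4 * M * B ((y - x) - (Z y - Z x)) h)"
          unfolding blinfun.diff_left k' diff_left by (simp add: right_diff_distrib)
        ultimately show "norm ((k' y - k' x) h) \<le> 20 * M * K\<^sup>2 * norm (y - x) * norm h"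
          using M by (simp add: abs_mult power2_eq_square mult_ac)
      qed (use M in auto)
      have "((\<lambda>y. 20 * M * K\<^sup>2 * norm (y - x)) \<longlongrightarrow> 0) (at x)"
        by (intro tendsto_mult_right_zero tendsto_norm_zero LIM_zero tendsto_ident_at)
      then have "((\<lambda>y. k' y - k' x) \<longlongrightarrow> 0) (at x)"
        by (rule Lim_null_comparison[rotated]) (simp add: bound)
      then show "(k' \<longlongrightarrow> k' x) (at x)"
        by (rule LIM_zero_cancel)
    qed
  qed
  moreover have "k x - k y \<le> L * N (x - y)" for x y
  proof -
    have "k x \<le> k y + L * N (x - y)"
    proof (rule k_le)
      fix z
      have "\<Phi> x z \<le> \<Phi> y (z + (y - x)) + L * N (x - y)"
        using w_L[of z "z + (y - x)"] unfolding \<Phi>_def by (simp add: N_minus_commute algebra_simps)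
      then show "\<Phi> x z \<le> k y + L * N (x - y)"
        using k_ge[of y "z + (y - x)"] by linarith
    qed
    then show ?thesis by simp
  qed
  moreover have "U x - \<eta> \<le> k x" "k x \<le> U x + \<eta>" for x
    using k_ge[of x x] w_U(1)[of x] k_le[OF \<Phi>_upper, of x] by (auto simp: \<Phi>_def Q_def zero_left)
  ultimately show ?thesis
    by (rule that)
qed

end

section \<open>A smoothed maximum\<close>

text \<open>A C^1 function that vanishes together with its derivative on the nonpositive reals and
  increases strictly on the positive ones. Functions below the smoothed maximum therefore leave no
  trace in the equation that defines it.\<close>

definition possq :: "real \<Rightarrow> real" where
  "possq s = (max 0 s)\<^sup>2"

lemma possq_nonpos [simp]: "s \<le> 0 \<Longrightarrow> possq s = 0"
  by (simp add: possq_def)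

lemma possq_mono: "s \<le> t \<Longrightarrow> possq s \<le> possq t"
  by (auto simp: possq_def intro!: power_mono)

lemma possq_strict_mono: "s < t \<Longrightarrow> 0 < t \<Longrightarrow> possq s < possq t"
  by (auto simp: possq_def max_def intro!: power_strict_mono)

lemma possq_nonneg [simp]: "0 \<le> possq s"
  by (simp add: possq_def)

text \<open>The derivative \<open>2 * max 0 s\<close> is Lipschitz with constant 2, which bounds the
  remainder uniformly in \<open>s\<close>. The cases follow the signs of \<open>s\<close> and
  \<open>s + h\<close>.\<close>

lemma possq_taylor: "\<bar>possq (s + h) - possq s - 2 * max 0 s * h\<bar> \<le> h\<^sup>2"
proof -
  consider "0 \<le> s" "0 \<le> s + h" | "s \<le> 0" "s + h \<le> 0" | "0 \<le> s" "s + h \<le> 0" | "s \<le> 0" "0 \<le> s + h"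
    by linarith
  then show ?thesis
  proof cases
    case 1
    then show ?thesis by (simp add: possq_def power2_eq_square algebra_simps)
  next
    case 2
    then show ?thesis by (simp add: possq_def)
  next
    case 3
    then have "(s + h)\<^sup>2 \<le> h\<^sup>2"
      by (intro abs_le_square_iff[THEN iffD1]) auto
    moreover have "possq (s + h) - possq s - 2 * max 0 s * h = h\<^sup>2 - (s + h)\<^sup>2"
      using 3 by (simp add: possq_def power2_eq_square algebra_simps)
    ultimately show ?thesis
      by (simp add: abs_le_iff)
  next
    case 4
    then have "(s + h)\<^sup>2 \<le> h\<^sup>2"
      by (intro power_mono) auto
    then show ?thesis
      using 4 by (simp add: possq_def)
  qed
qed

lemma possq_has_derivative: "(possq has_real_derivative 2 * max 0 s) (at s)"
proof -
  have "((\<lambda>t. possq t - possq s - 2 * max 0 s * (t - s)) has_derivative (\<lambda>_. 0)) (at s)"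
  proof (rule has_derivative_zero_of_quadratic_bound[where K = 1], rule always_eventually, rule allI)
    show "\<bar>possq t - possq s - 2 * max 0 s * (t - s)\<bar> \<le> 1 * (norm (t - s))\<^sup>2" for t
      using possq_taylor[of s "t - s"] by simp
  qed
  then have "((\<lambda>t. (possq t - possq s - 2 * max 0 s * (t - s)) + (possq s + 2 * max 0 s * (t - s)))
      has_derivative (\<lambda>h. 0 + 2 * max 0 s * h)) (at s)"
    by (rule has_derivative_add) (auto intro!: derivative_eq_intros)
  then show ?thesis
    by (simp add: has_field_derivative_def)
qed

lemma continuous_on_possq [continuous_intros]:
  "continuous_on S f \<Longrightarrow> continuous_on S (\<lambda>x. possq (f x))"
  unfolding possq_def by (intro continuous_intros)

text \<open>
  The implicit equation defines a smoothed maximum of the functions \<open>g i\<close>: it commutes with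
  adding constants and is monotone, so its derivative is a convex combination of those of the
  active \<open>g i\<close> and obeys any common bound for them, whatever the number of functions.
\<close>

lemma has_derivative_imp_locally_lipschitz:
  assumes "(f has_derivative f') (at x)"
  shows "\<exists>K\<ge>0. \<forall>\<^sub>F y in nhds x. norm (f y - f x) \<le> K * norm (y - x)"
proof -
  obtain d where "d > 0" and d: "\<And>y. norm (y - x) < d \<Longrightarrow> norm (f y - f x - f' (y - x)) \<le> 1 * norm (y - x)"
    using assms unfolding has_derivative_at_alt by (meson zero_less_one)
  have "norm (f y - f x) \<le> (1 + onorm f') * norm (y - x)" if "dist y x < d" for y
    using d[of y] onorm[OF has_derivative_bounded_linear[OF assms], of "y - x"] that
      norm_triangle_ineq[of "f y - f x - f' (y - x)" "f' (y - x)"]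
    by (simp add: dist_norm algebra_simps)
  then show ?thesis
    using \<open>d > 0\<close> onorm_pos_le[OF has_derivative_bounded_linear[OF assms]]
    by (intro exI[of _ "1 + onorm f'"]) (auto simp: eventually_nhds_metric)
qed

locale smooth_max =
  fixes W :: "'e::real_normed_vector set" and J :: "'i set"
    and g :: "'i \<Rightarrow> 'e \<Rightarrow> real" and e :: "'i \<Rightarrow> real" and T :: "'e \<Rightarrow> real"
  assumes open_W: "open W" and finite_J: "finite J"
    and g_C1: "\<And>i. i \<in> J \<Longrightarrow> C1_on W (g i)" and e_pos: "\<And>i. i \<in> J \<Longrightarrow> 0 < e i"
    and T_eq: "\<And>x. x \<in> W \<Longrightarrow> (\<Sum>i\<in>J. possq ((g i x - T x) / e i)) = 1"
begin

lemma ex_active: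
  assumes "x \<in> W"
  obtains i where "i \<in> J" "T x < g i x"
proof (rule ccontr)
  assume "\<not> thesis"
  with that have "\<forall>i\<in>J. g i x \<le> T x"
    by force
  then have "\<forall>i\<in>J. possq ((g i x - T x) / e i) = 0"
    using e_pos by (auto simp: divide_nonpos_pos)
  then show False
    using T_eq[OF assms] by simp
qed

text \<open>If \<open>T\<close> rose by more than all the changes of the \<open>g i\<close>
  together, every quotient \<open>(g i - T) / e i\<close> would drop strictly. As some index is
  active at \<open>x\<close>, the sum would then fall below 1. This bound on \<open>T\<close> comes
  before differentiability and is used to prove it.\<close>

lemma T_diff_le:
  assumes "x \<in> W" "y \<in> W"
  shows "T y - T x \<le> (\<Sum>i\<in>J. \<bar>g i y - g i x\<bar>)"
proof (rule ccontr)
  assume *: "\<not> ?thesis"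
  have less: "(g i y - T y) / e i < (g i x - T x) / e i" if "i \<in> J" for i
  proof -
    have "\<bar>g i y - g i x\<bar> \<le> (\<Sum>i\<in>J. \<bar>g i y - g i x\<bar>)"
      using finite_J that by (intro member_le_sum) auto
    then have "g i y - T y < g i x - T x"
      using * by linarith
    then show ?thesis
      using e_pos[OF that] by (rule divide_strict_right_mono)
  qed
  obtain i where i: "i \<in> J" "0 < (g i x - T x) / e i"
    using ex_active[OF assms(1)] e_pos by (metis diff_gt_0_iff_gt divide_pos_pos)
  have "(\<Sum>i\<in>J. possq ((g i y - T y) / e i)) < (\<Sum>i\<in>J. possq ((g i x - T x) / e i))"
    using finite_J less i by (intro sum_strict_mono_ex1) (auto intro: possq_mono possq_strict_mono less_imp_le)
  then show False
    using T_eq assms by simp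
qed

lemma T_abs_diff_le:
  assumes "x \<in> W" "y \<in> W"
  shows "\<bar>T y - T x\<bar> \<le> (\<Sum>i\<in>J. \<bar>g i y - g i x\<bar>)"
  using T_diff_le[OF assms] T_diff_le[OF assms(2,1)] by (simp add: abs_minus_commute)

text \<open>Half the partial derivative of the \<open>i\<close>-th summand of the equation with
  respect to \<open>g i x\<close>. Divided by their sum, the weights are the coefficients of the
  convex combination \<open>T'\<close>.\<close>

definition weight :: "'i \<Rightarrow> 'e \<Rightarrow> real" where
  "weight i x = max 0 ((g i x - T x) / e i) / e i"

lemma weight_nonneg: "i \<in> J \<Longrightarrow> 0 \<le> weight i x"
  using e_pos[of i] by (simp add: weight_def)

lemma sum_weight_pos:
  assumes "x \<in> W"
  shows "0 < (\<Sum>i\<in>J. weight i x)"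
proof -
  obtain i where i: "i \<in> J" "0 < (g i x - T x) / e i"
    using ex_active[OF assms(1)] e_pos by (metis diff_gt_0_iff_gt divide_pos_pos)
  have "0 < weight i x"
    unfolding weight_def by (intro divide_pos_pos e_pos i) (use i in simp)
  then show ?thesis
    using i finite_J weight_nonneg by (intro sum_pos2[of J i]) auto
qed

definition T' :: "'e \<Rightarrow> 'e \<Rightarrow>\<^sub>L real" where
  "T' x = (1 / (\<Sum>i\<in>J. weight i x)) *\<^sub>R (\<Sum>i\<in>J. weight i x *\<^sub>R Blinfun (frechet_derivative (g i) (at x)))"

lemma T'_apply:
  assumes "x \<in> W"
  shows "T' x v = (\<Sum>i\<in>J. weight i x * frechet_derivative (g i) (at x) v) / (\<Sum>i\<in>J. weight i x)"
proof -
  have "blinfun_apply (Blinfun (frechet_derivative (g i) (at x))) v = frechet_derivative (g i) (at x) v" if "i \<in> J" for i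
    using C1_on_derivative[OF g_C1[OF that] assms]
    by (simp add: bounded_linear_Blinfun_apply has_derivative_bounded_linear)
  then show ?thesis
    by (simp add: T'_def blinfun.scaleR_left blinfun.sum_left)
qed

text \<open>Implicit differentiation by hand. Subtracting the equations at \<open>x\<close> and
  \<open>y\<close> and expanding each \<open>possq\<close> to first order, the linear terms add up
  to \<open>- 2 * r y\<close>, so \<open>r y\<close> is half a sum of Taylor remainders and thus of
  second order.\<close>

lemma T_has_derivative:
  assumes x: "x \<in> W"
  shows "(T has_derivative T' x) (at x)"
proof -
  define S where "S = (\<Sum>i\<in>J. weight i x)"
  have S: "0 < S"
    using sum_weight_pos[OF x] by (simp add: S_def)
  define r where "r y = S * (T y - T x) - (\<Sum>i\<in>J. weight i x * (g i y - g i x))" for y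
  \<comment> \<open>The inner factor 2 accounts for the change of \<open>g i\<close> and that of
    \<open>T\<close>, each at most the inner sum. The outer division by 2 reflects that the
    remainders sum to \<open>2 * r y\<close>.\<close>
  define h where "h y = (\<Sum>i\<in>J. ((2 / e i) * (\<Sum>i\<in>J. \<bar>g i y - g i x\<bar>))\<^sup>2) / 2" for y
  have r: "\<bar>r y\<bar> \<le> h y" if y: "y \<in> W" for y
  proof -
    define d where "d i = (g i y - T y) / e i - (g i x - T x) / e i" for i
    define \<rho> where "\<rho> i = possq ((g i x - T x) / e i + d i) - possq ((g i x - T x) / e i) - 2 * max 0 ((g i x - T x) / e i) * d i" for i
    have "\<bar>\<rho> i\<bar> \<le> ((2 / e i) * (\<Sum>i\<in>J. \<bar>g i y - g i x\<bar>))\<^sup>2" if i: "i \<in> J" for i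
    proof -
      have "\<bar>g i y - g i x\<bar> \<le> (\<Sum>i\<in>J. \<bar>g i y - g i x\<bar>)"
        using finite_J i by (intro member_le_sum) auto
      then have "\<bar>(g i y - g i x) - (T y - T x)\<bar> \<le> 2 * (\<Sum>i\<in>J. \<bar>g i y - g i x\<bar>)"
        using T_abs_diff_le[OF x y] by linarith
      moreover have "\<bar>d i\<bar> = \<bar>(g i y - g i x) - (T y - T x)\<bar> / e i"
        using e_pos[OF i] by (simp add: d_def diff_divide_distrib[symmetric] algebra_simps)
      ultimately have "\<bar>d i\<bar> \<le> (2 / e i) * (\<Sum>i\<in>J. \<bar>g i y - g i x\<bar>)"
        using e_pos[OF i] by (simp add: divide_right_mono)
      then have "(d i)\<^sup>2 \<le> ((2 / e i) * (\<Sum>i\<in>J. \<bar>g i y - g i x\<bar>))\<^sup>2"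
        by (metis abs_ge_zero power2_abs power_mono)
      then show ?thesis
        using possq_taylor[of "(g i x - T x) / e i" "d i"] by (simp add: \<rho>_def)
    qed
    then have "\<bar>\<Sum>i\<in>J. \<rho> i\<bar> \<le> 2 * h y"
      unfolding h_def by (simp add: order_trans[OF sum_abs sum_mono])
    moreover have "(\<Sum>i\<in>J. \<rho> i) = 2 * r y"
    proof -
      have "(\<Sum>i\<in>J. \<rho> i) = (\<Sum>i\<in>J. possq ((g i y - T y) / e i)) - (\<Sum>i\<in>J. possq ((g i x - T x) / e i))
          - (\<Sum>i\<in>J. 2 * max 0 ((g i x - T x) / e i) * d i)"
        by (simp add: \<rho>_def sum_subtractf d_def)
      also have "(\<Sum>i\<in>J. 2 * max 0 ((g i x - T x) / e i) * d i)
          = (\<Sum>i\<in>J. 2 * (weight i x * (g i y - g i x)) - 2 * (weight i x * (T y - T x)))"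
        by (intro sum.cong refl) (simp add: weight_def d_def diff_divide_distrib algebra_simps)
      finally show ?thesis
        using T_eq[OF x] T_eq[OF y]
        by (simp add: r_def S_def sum_subtractf sum_distrib_left[symmetric] sum_distrib_right[symmetric])
    qed
    ultimately show ?thesis by simp
  qed
  have "\<exists>K\<ge>0. \<forall>\<^sub>F y in nhds x. \<bar>g i y - g i x\<bar> \<le> K * norm (y - x)" if "i \<in> J" for i
    using has_derivative_imp_locally_lipschitz[OF C1_on_derivative[OF g_C1[OF that] x]] by simp
  then obtain K where K: "\<And>i. i \<in> J \<Longrightarrow> \<forall>\<^sub>F y in nhds x. \<bar>g i y - g i x\<bar> \<le> K i * norm (y - x)"
    by metis
  define C where "C = (\<Sum>i\<in>J. (2 / e i * (\<Sum>i\<in>J. K i))\<^sup>2) / 2"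
  have "\<forall>\<^sub>F y in nhds x. \<forall>i\<in>J. \<bar>g i y - g i x\<bar> \<le> K i * norm (y - x)"
    using K finite_J by (simp add: eventually_ball_finite)
  moreover have "\<forall>\<^sub>F y in nhds x. y \<in> W"
    using open_W x by (rule eventually_nhds_in_open)
  ultimately have "\<forall>\<^sub>F y in nhds x. \<bar>r y\<bar> \<le> C * (norm (y - x))\<^sup>2"
  proof eventually_elim
    case (elim y)
    have "(\<Sum>i\<in>J. \<bar>g i y - g i x\<bar>) \<le> (\<Sum>i\<in>J. K i) * norm (y - x)"
      unfolding sum_distrib_right using elim by (intro sum_mono) auto
    then have "2 / e i * (\<Sum>i\<in>J. \<bar>g i y - g i x\<bar>) \<le> 2 / e i * (\<Sum>i\<in>J. K i) * norm (y - x)" if "i \<in> J" for i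
      using mult_left_mono[of _ _ "2 / e i"] e_pos[OF that] by (simp add: mult.assoc)
    then have "h y \<le> (\<Sum>i\<in>J. (2 / e i * (\<Sum>i\<in>J. K i) * norm (y - x))\<^sup>2) / 2"
      unfolding h_def using e_pos
      by (intro divide_right_mono sum_mono power_mono) (auto intro!: mult_nonneg_nonneg sum_nonneg simp: less_imp_le)
    also have "\<dots> = C * (norm (y - x))\<^sup>2"
      by (simp add: C_def power_mult_distrib sum_distrib_right[symmetric] del: times_divide_eq_left)
    finally show ?case
      using r[of y] elim by simp
  qed
  then have r': "(r has_derivative (\<lambda>_. 0)) (at x)"
    by (rule has_derivative_zero_of_quadratic_bound)
  have T_alt: "T = (\<lambda>y. T x + (r y + (\<Sum>i\<in>J. weight i x * (g i y - g i x))) / S)"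
    using S by (auto simp: r_def)
  have "((\<lambda>y. T x + (r y + (\<Sum>i\<in>J. weight i x * (g i y - g i x))) / S) has_derivative
      (\<lambda>v. 0 + (0 + (\<Sum>i\<in>J. weight i x * (frechet_derivative (g i) (at x) v - 0))) / S)) (at x)"
    unfolding divide_inverse
    by (intro has_derivative_add has_derivative_const r' has_derivative_mult_left has_derivative_sum
        has_derivative_mult_right has_derivative_diff C1_on_derivative[OF g_C1] x)
  then have "(T has_derivative (\<lambda>v. (\<Sum>i\<in>J. weight i x * frechet_derivative (g i) (at x) v) / S)) (at x)"
    by (subst T_alt) simp
  moreover have "(\<lambda>v. (\<Sum>i\<in>J. weight i x * frechet_derivative (g i) (at x) v) / S) = blinfun_apply (T' x)"
    by (rule ext) (simp add: T'_apply[OF x] S_def)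
  ultimately show ?thesis
    by simp
qed

lemma C1_on_T: "C1_on W T"
  unfolding C1_on_def
proof (intro exI[of _ T'] conjI ballI T_has_derivative)
  have T: "continuous_on W T"
    using T_has_derivative by (intro continuous_at_imp_continuous_on) (auto dest: has_derivative_continuous)
  have weight: "continuous_on W (weight i)" if "i \<in> J" for i
    unfolding weight_def using e_pos[OF that]
    by (intro continuous_intros T C1_on_imp_continuous_on[OF g_C1[OF that]]) auto
  have "continuous_on W (\<lambda>x. \<Sum>i\<in>J. weight i x *\<^sub>R Blinfun (frechet_derivative (g i) (at x)))"
    using g_C1 weight by (intro continuous_intros) (auto simp: C1_on_iff_frechet)
  moreover have "continuous_on W (\<lambda>x. 1 / (\<Sum>i\<in>J. weight i x))"
    using sum_weight_pos by (intro continuous_intros weight) (auto simp: less_le)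
  ultimately show "continuous_on W T'"
    unfolding T'_def by (intro continuous_on_scaleR)
qed

lemma T_derivative_bound:
  assumes x: "x \<in> W"
    and K: "\<And>i. i \<in> J \<Longrightarrow> T x < g i x \<Longrightarrow> \<bar>frechet_derivative (g i) (at x) v\<bar> \<le> K"
  shows "\<bar>frechet_derivative T (at x) v\<bar> \<le> K"
proof -
  have "\<bar>\<Sum>i\<in>J. weight i x * frechet_derivative (g i) (at x) v\<bar> \<le> (\<Sum>i\<in>J. weight i x * K)"
  proof (intro order_trans[OF sum_abs sum_mono])
    fix i assume i: "i \<in> J"
    show "\<bar>weight i x * frechet_derivative (g i) (at x) v\<bar> \<le> weight i x * K"
    proof (cases "T x < g i x")
      case True
      then show ?thesis
        using K[OF i True] weight_nonneg[OF i, of x] by (simp add: abs_mult mult_left_mono)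
    next
      case False
      then have "weight i x = 0"
        using e_pos[OF i] by (simp add: weight_def divide_nonpos_pos)
      then show ?thesis by simp
    qed
  qed
  moreover have "frechet_derivative T (at x) v = T' x v"
    using frechet_derivative_at[OF T_has_derivative[OF x]] by simp
  ultimately show ?thesis
    using sum_weight_pos[OF x]
    by (simp add: T'_apply[OF x] sum_distrib_right[symmetric] pos_divide_le_eq mult.commute[of K])
qed

end

section \<open>Charts and tangent vectors\<close>

context hilbert_manifold
begin

abbreviation image_of :: "('m, 'e) chart \<Rightarrow> 'e set" where
  "image_of \<kappa> \<equiv> chart_map \<kappa> ` chart_dom \<kappa>"

abbreviation transition :: "('m, 'e) chart \<Rightarrow> ('m, 'e) chart \<Rightarrow> 'e \<Rightarrow> 'e" where
  "transition \<kappa> \<mu> \<equiv> chart_map \<mu> \<circ> chart_inv \<kappa>"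

lemma chart_dom_subset: "\<kappa> \<in> \<A> \<Longrightarrow> chart_dom \<kappa> \<subseteq> topspace X"
  using open_chart_dom openin_subset by blast

lemma topspace_Int_chart_dom [simp]: "\<kappa> \<in> \<A> \<Longrightarrow> topspace X \<inter> chart_dom \<kappa> = chart_dom \<kappa>"
  using chart_dom_subset by blast

lemma chart_inv_chart_map [simp]:
  assumes "\<kappa> \<in> \<A>" "p \<in> chart_dom \<kappa>"
  shows "chart_inv \<kappa> (chart_map \<kappa> p) = p"
  using homeomorphic_imp_injective_map[OF chart_homeomorphic[OF assms(1)]] assms
  by (simp add: chart_inv_def)

lemma chart_map_chart_inv: "x \<in> image_of \<kappa> \<Longrightarrow> chart_map \<kappa> (chart_inv \<kappa> x) = x"
  by (simp add: chart_inv_def f_inv_into_f)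

lemma chart_inv_in_dom: "x \<in> image_of \<kappa> \<Longrightarrow> chart_inv \<kappa> x \<in> chart_dom \<kappa>"
  by (simp add: chart_inv_def inv_into_into)

lemma continuous_chart_map:
  assumes "\<kappa> \<in> \<A>"
  shows "continuous_map (subtopology X (chart_dom \<kappa>)) euclidean (chart_map \<kappa>)"
  using homeomorphic_imp_continuous_map[OF chart_homeomorphic[OF assms]] continuous_map_into_fulltopology by blast

lemma continuous_chart_inv:
  assumes \<kappa>: "\<kappa> \<in> \<A>"
  shows "continuous_map (top_of_set (image_of \<kappa>)) (subtopology X (chart_dom \<kappa>)) (chart_inv \<kappa>)"
proof -
  obtain h where "homeomorphic_maps (subtopology X (chart_dom \<kappa>)) (top_of_set (image_of \<kappa>)) (chart_map \<kappa>) h"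
    using chart_homeomorphic[OF \<kappa>] homeomorphic_map_maps by blast
  then have h: "continuous_map (top_of_set (image_of \<kappa>)) (subtopology X (chart_dom \<kappa>)) h"
    and inv: "\<And>q. q \<in> chart_dom \<kappa> \<Longrightarrow> h (chart_map \<kappa> q) = q"
    using \<kappa> by (auto simp: homeomorphic_maps_def)
  show ?thesis
    by (rule continuous_map_eq[OF h]) (use \<kappa> in \<open>auto simp: inv\<close>)
qed

lemma openin_chart_preimage:
  assumes \<kappa>: "\<kappa> \<in> \<A>" and "open S"
  shows "openin X {q \<in> chart_dom \<kappa>. chart_map \<kappa> q \<in> S}"
proof -
  have "openin (subtopology X (chart_dom \<kappa>)) {q \<in> topspace (subtopology X (chart_dom \<kappa>)). chart_map \<kappa> q \<in> S}"
    using continuous_chart_map[OF \<kappa>] by (rule openin_continuous_map_preimage) (use \<open>open S\<close> in simp)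
  then show ?thesis
    using open_chart_dom[OF \<kappa>] chart_dom_subset[OF \<kappa>]
    by (simp add: openin_open_subtopology) (smt (verit) Collect_cong subsetD)
qed

lemma open_chart_image_Int:
  assumes \<kappa>: "\<kappa> \<in> \<A>" and V: "openin X V"
  shows "open (chart_map \<kappa> ` (V \<inter> chart_dom \<kappa>))"
proof -
  have "openin (subtopology X (chart_dom \<kappa>)) (V \<inter> chart_dom \<kappa>)"
    using V by (rule openin_subtopology_Int)
  then have "openin (top_of_set (image_of \<kappa>)) (chart_map \<kappa> ` (V \<inter> chart_dom \<kappa>))"
    using homeomorphic_imp_open_map[OF chart_homeomorphic[OF \<kappa>]] by (simp add: open_map_def)
  then show ?thesis
    using open_chart_image[OF \<kappa>] by (simp add: openin_open_eq)
qed

lemma transition_C1: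
  assumes "\<kappa> \<in> \<A>" "\<mu> \<in> \<A>"
  shows "C1_on (chart_map \<kappa> ` (chart_dom \<kappa> \<inter> chart_dom \<mu>)) (transition \<kappa> \<mu>)"
proof (rule smooth_on_imp_C1_on)
  show "open (chart_map \<kappa> ` (chart_dom \<kappa> \<inter> chart_dom \<mu>))"
    using open_chart_image_Int[OF assms(1) open_chart_dom[OF assms(2)]] by (simp add: Int_commute)
qed (use smooth_transition assms in blast)

lemma transition_has_derivative:
  assumes "\<kappa> \<in> charts_at \<A> p" "\<mu> \<in> charts_at \<A> p"
  shows "(transition \<kappa> \<mu> has_derivative
    frechet_derivative (transition \<kappa> \<mu>) (at (chart_map \<kappa> p))) (at (chart_map \<kappa> p))"
  using assms by (intro C1_on_derivative[OF transition_C1]) (auto simp: charts_at_def)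

lemma C1_on_change_chart:
  fixes F :: "'m \<Rightarrow> 'b::real_normed_vector"
  assumes \<kappa>: "\<kappa> \<in> \<A>" and \<mu>: "\<mu> \<in> \<A>" and V: "openin X V" "V \<subseteq> chart_dom \<mu>"
    and F: "C1_on (chart_map \<mu> ` V) (F \<circ> chart_inv \<mu>)"
  shows "C1_on (chart_map \<kappa> ` (V \<inter> chart_dom \<kappa>)) (F \<circ> chart_inv \<kappa>)"
proof (rule C1_on_cong)
  show "open (chart_map \<kappa> ` (V \<inter> chart_dom \<kappa>))"
    using \<kappa> V(1) by (rule open_chart_image_Int)
  have "C1_on (chart_map \<kappa> ` (V \<inter> chart_dom \<kappa>)) (transition \<kappa> \<mu>)"
    by (rule C1_on_subset[OF transition_C1[OF \<kappa> \<mu>]]) (use V in auto)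
  then show "C1_on (chart_map \<kappa> ` (V \<inter> chart_dom \<kappa>)) ((F \<circ> chart_inv \<mu>) \<circ> transition \<kappa> \<mu>)"
    by (rule C1_on_compose[OF _ F]) (use \<kappa> in auto)
  show "((F \<circ> chart_inv \<mu>) \<circ> transition \<kappa> \<mu>) x = (F \<circ> chart_inv \<kappa>) x"
    if "x \<in> chart_map \<kappa> ` (V \<inter> chart_dom \<kappa>)" for x
    using that V \<kappa> \<mu> by auto
qed

lemma derivative_change_chart:
  fixes F :: "'m \<Rightarrow> 'b::real_normed_vector"
  assumes \<kappa>: "\<kappa> \<in> charts_at \<A> p" and \<mu>: "\<mu> \<in> charts_at \<A> p"
    and F: "(F \<circ> chart_inv \<mu> has_derivative F') (at (chart_map \<mu> p))"
  shows "(F \<circ> chart_inv \<kappa> has_derivative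
    F' \<circ> frechet_derivative (transition \<kappa> \<mu>) (at (chart_map \<kappa> p))) (at (chart_map \<kappa> p))"
proof (rule has_derivative_transform_within_open)
  have \<kappa>': "\<kappa> \<in> \<A>" "p \<in> chart_dom \<kappa>" and \<mu>': "\<mu> \<in> \<A>" "p \<in> chart_dom \<mu>"
    using \<kappa> \<mu> by (auto simp: charts_at_def)
  show "((F \<circ> chart_inv \<mu>) \<circ> transition \<kappa> \<mu> has_derivative
    F' \<circ> frechet_derivative (transition \<kappa> \<mu>) (at (chart_map \<kappa> p))) (at (chart_map \<kappa> p))"
    using \<kappa>' F by (intro diff_chain_at transition_has_derivative \<kappa> \<mu>) simp
  show "open (chart_map \<kappa> ` (chart_dom \<mu> \<inter> chart_dom \<kappa>))"
    using open_chart_image_Int[OF \<kappa>'(1) open_chart_dom[OF \<mu>'(1)]] .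
  show "chart_map \<kappa> p \<in> chart_map \<kappa> ` (chart_dom \<mu> \<inter> chart_dom \<kappa>)"
    using \<kappa>' \<mu>' by blast
  show "((F \<circ> chart_inv \<mu>) \<circ> transition \<kappa> \<mu>) x = (F \<circ> chart_inv \<kappa>) x"
    if "x \<in> chart_map \<kappa> ` (chart_dom \<mu> \<inter> chart_dom \<kappa>)" for x
    using that \<kappa>' \<mu>' by auto
qed

lemma tangent_space_change_chart:
  assumes "v \<in> tangent_space \<A> p" "\<kappa> \<in> charts_at \<A> p" "\<mu> \<in> charts_at \<A> p"
  shows "v \<mu> = frechet_derivative (transition \<kappa> \<mu>) (at (chart_map \<kappa> p)) (v \<kappa>)"
  using assms unfolding tangent_space_def by blast

text \<open>Compatibility of the coordinates is the cocycle rule for the derivatives of transition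
  maps, obtained from \<open>derivative_change_chart\<close> with a chart map in the role of
  \<open>F\<close>.\<close>

lemma tangent_vector_of_coordinates:
  assumes \<kappa>: "\<kappa> \<in> charts_at \<A> p"
  shows "(\<lambda>\<mu>. if \<mu> \<in> charts_at \<A> p
    then frechet_derivative (transition \<kappa> \<mu>) (at (chart_map \<kappa> p)) x else 0) \<in> tangent_space \<A> p"
  unfolding tangent_space_def
proof (intro CollectI conjI allI impI ballI)
  fix \<mu> \<nu> assume \<mu>: "\<mu> \<in> charts_at \<A> p" and \<nu>: "\<nu> \<in> charts_at \<A> p"
  have chain: "frechet_derivative (transition \<kappa> \<nu>) (at (chart_map \<kappa> p)) =
    frechet_derivative (transition \<mu> \<nu>) (at (chart_map \<mu> p)) \<circ> frechet_derivative (transition \<kappa> \<mu>) (at (chart_map \<kappa> p))"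
    by (rule frechet_derivative_at[OF derivative_change_chart[where F = "chart_map \<nu>",
          OF \<kappa> \<mu> transition_has_derivative[OF \<mu> \<nu>]], symmetric])
  show "(if \<nu> \<in> charts_at \<A> p then frechet_derivative (transition \<kappa> \<nu>) (at (chart_map \<kappa> p)) x else 0) =
      frechet_derivative (transition \<mu> \<nu>) (at (chart_map \<mu> p))
        (if \<mu> \<in> charts_at \<A> p then frechet_derivative (transition \<kappa> \<mu>) (at (chart_map \<kappa> p)) x else 0)"
    using fun_cong[OF chain, of x] by (simp only: \<mu> \<nu> if_True o_apply)
qed simp

lemma transition_self_derivative:
  assumes \<kappa>: "\<kappa> \<in> charts_at \<A> p"
  shows "frechet_derivative (transition \<kappa> \<kappa>) (at (chart_map \<kappa> p)) = (\<lambda>x. x)"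
proof (rule frechet_derivative_at[symmetric], rule has_derivative_transform_within_open)
  show "((\<lambda>x. x) has_derivative (\<lambda>x. x)) (at (chart_map \<kappa> p))"
    by (rule has_derivative_ident)
  show "open (image_of \<kappa>)" "chart_map \<kappa> p \<in> image_of \<kappa>"
    using \<kappa> open_chart_image by (auto simp: charts_at_def)
qed (simp add: chart_map_chart_inv)

text \<open>Lets properties of the metric on the tangent space at \<open>p\<close>, such as symmetry
  and coercivity, be transferred to its coordinate form on all of the model space.\<close>

lemma ex_tangent_vector:
  assumes "\<kappa> \<in> charts_at \<A> p"
  obtains v where "v \<in> tangent_space \<A> p" "v \<kappa> = x"
  using tangent_vector_of_coordinates[OF assms, of x]
  by (rule that) (simp add: transition_self_derivative assms)

end

section \<open>Charts in which the metric is almost constant\<close>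

context riemannian_manifold
begin

lemma metric_in_chart:
  assumes \<kappa>: "\<kappa> \<in> \<A>"
  obtains G :: "'e \<Rightarrow> 'e \<Rightarrow>\<^sub>L 'e \<Rightarrow>\<^sub>L real"
  where "continuous_on (image_of \<kappa>) G"
    and "\<And>p v w. p \<in> chart_dom \<kappa> \<Longrightarrow> v \<in> tangent_space \<A> p \<Longrightarrow> w \<in> tangent_space \<A> p \<Longrightarrow>
      g p v w = G (chart_map \<kappa> p) (v \<kappa>) (w \<kappa>)"
proof -
  obtain G :: "'e \<Rightarrow> 'e \<Rightarrow>\<^sub>L 'e \<Rightarrow>\<^sub>L real" where G: "smooth_on (image_of \<kappa>) G"
    and g: "\<forall>p\<in>chart_dom \<kappa>. \<forall>v\<in>tangent_space \<A> p. \<forall>w\<in>tangent_space \<A> p.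
      g p v w = G (chart_map \<kappa> p) (v \<kappa>) (w \<kappa>)"
    using metric_smooth[OF \<kappa>] by blast
  show ?thesis
    by (rule that[OF C1_on_imp_continuous_on[OF smooth_on_imp_C1_on[OF open_chart_image[OF \<kappa>] G]]])
      (use g in blast)
qed

text \<open>Convexity keeps coordinate segments inside \<open>S\<close>. The upper estimate of
  \<open>tangent_norm\<close> bounds their lengths; the lower one turns derivative bounds in terms
  of \<open>N\<close> into bounds for the Riemannian norm.\<close>

definition near_euclidean :: "('m, 'e) chart \<Rightarrow> ('e \<Rightarrow> 'e \<Rightarrow> real) \<Rightarrow> 'e set \<Rightarrow> bool" where
  "near_euclidean \<kappa> B S \<longleftrightarrow> \<kappa> \<in> \<A> \<and> equivalent_inner B \<and> open S \<and> convex S \<and> S \<subseteq> image_of \<kappa> \<and>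
     (\<forall>q\<in>chart_dom \<kappa>. chart_map \<kappa> q \<in> S \<longrightarrow> (\<forall>v\<in>tangent_space \<A> q.
        equivalent_inner.N B (v \<kappa>) \<le> 2 * tangent_norm g q v \<and>
        tangent_norm g q v \<le> 2 * equivalent_inner.N B (v \<kappa>)))"

lemma ex_near_euclidean:
  assumes p: "p \<in> topspace X"
  obtains \<kappa> B S where "near_euclidean \<kappa> B S" "p \<in> chart_dom \<kappa>" "chart_map \<kappa> p \<in> S"
proof -
  obtain \<kappa> where \<kappa>: "\<kappa> \<in> \<A>" "p \<in> chart_dom \<kappa>"
    using p atlas_covers by blast
  then have at_p: "\<kappa> \<in> charts_at \<A> p"
    by (simp add: charts_at_def)
  obtain G :: "'e \<Rightarrow> 'e \<Rightarrow>\<^sub>L 'e \<Rightarrow>\<^sub>L real" where G: "continuous_on (image_of \<kappa>) G"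
    and g: "\<And>p v w. p \<in> chart_dom \<kappa> \<Longrightarrow> v \<in> tangent_space \<A> p \<Longrightarrow> w \<in> tangent_space \<A> p \<Longrightarrow>
      g p v w = G (chart_map \<kappa> p) (v \<kappa>) (w \<kappa>)"
    using metric_in_chart[OF \<kappa>(1)] by blast
  define x where "x = chart_map \<kappa> p"
  define B where "B u v = G x u v" for u v
  have g_p: "g p v w = B (v \<kappa>) (w \<kappa>)" if "v \<in> tangent_space \<A> p" "w \<in> tangent_space \<A> p" for v w
    using g[OF \<kappa>(2) that] by (simp add: B_def x_def)
  obtain C where C: "C > 0" "\<And>v. v \<in> tangent_space \<A> p \<Longrightarrow> norm (v \<kappa>) \<le> C * sqrt (g p v v)"
    using metric_equivalent[OF p at_p] by blast
  have coercive: "(norm u)\<^sup>2 \<le> C\<^sup>2 * B u u" for u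
  proof -
    obtain v where v: "v \<in> tangent_space \<A> p" "v \<kappa> = u"
      using ex_tangent_vector[OF at_p] .
    have bound: "norm u \<le> C * sqrt (B u u)"
      using C(2)[OF v(1)] g_p[OF v(1) v(1)] v(2) by simp
    \<comment> \<open>In HOL the function \<open>sqrt\<close> is odd, so a nonnegative value of it
      forces a nonnegative argument.\<close>
    then have "0 \<le> C * sqrt (B u u)"
      using norm_ge_zero order_trans by blast
    then have "0 \<le> B u u"
      using C(1) by (simp add: zero_le_mult_iff)
    then show ?thesis
      using power_mono[OF bound norm_ge_zero, of 2] by (simp add: power_mult_distrib)
  qed
  interpret B: equivalent_inner B
  proof (rule equivalent_inner.intro)
    show "bounded_bilinear B"
      unfolding B_def by (rule bounded_bilinear.comp1[OF bounded_bilinear_blinfun_apply blinfun.bounded_linear_right])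
    show "B u v = B v u" for u v
    proof -
      obtain u' where "u' \<in> tangent_space \<A> p" "u' \<kappa> = u"
        using ex_tangent_vector[OF at_p] .
      moreover obtain v' where "v' \<in> tangent_space \<A> p" "v' \<kappa> = v"
        using ex_tangent_vector[OF at_p] .
      ultimately show ?thesis
        using metric_sym[OF p] g_p by metis
    qed
    show "\<exists>c>0. \<forall>v. c * (norm v)\<^sup>2 \<le> B v v"
      using coercive C(1) by (intro exI[of _ "1 / C\<^sup>2"]) (simp add: pos_divide_le_eq mult.commute)
  qed
  have "x \<in> image_of \<kappa>"
    using \<kappa> by (simp add: x_def)
  then have "isCont G x"
    using G open_chart_image[OF \<kappa>(1)] continuous_on_eq_continuous_at by blast
  \<comment> \<open>With \<open>coercive\<close>, a deviation of \<open>G\<close> by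
    \<open>1 / (2 * C\<^sup>2)\<close> changes the quadratic form by at most half of
    \<open>B u u\<close>. The two forms then agree up to a factor 4, and the norms up to a factor
    2.\<close>
  then have "\<forall>\<^sub>F y in nhds x. dist (G y) (G x) < 1 / (2 * C\<^sup>2)"
    using C(1) by (intro tendstoD) (auto simp: isCont_def tendsto_at_iff_tendsto_nhds)
  moreover have "\<forall>\<^sub>F y in nhds x. y \<in> image_of \<kappa>"
    using open_chart_image[OF \<kappa>(1)] \<open>x \<in> image_of \<kappa>\<close> by (rule eventually_nhds_in_open)
  ultimately have "\<forall>\<^sub>F y in nhds x. dist (G y) (G x) < 1 / (2 * C\<^sup>2) \<and> y \<in> image_of \<kappa>"
    by (rule eventually_conj)
  then obtain d where d: "d > 0" "\<And>y. dist y x < d \<Longrightarrow> dist (G y) (G x) < 1 / (2 * C\<^sup>2) \<and> y \<in> image_of \<kappa>"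
    unfolding eventually_nhds_metric by blast
  have "near_euclidean \<kappa> B (ball x d)"
    unfolding near_euclidean_def
  proof (intro conjI ballI impI)
    show "equivalent_inner B"
      by (rule B.equivalent_inner_axioms)
    show "ball x d \<subseteq> image_of \<kappa>"
      using d(2) by (auto simp: dist_commute)
    fix q v assume q: "q \<in> chart_dom \<kappa>" "chart_map \<kappa> q \<in> ball x d" and v: "v \<in> tangent_space \<A> q"
    have "norm (G (chart_map \<kappa> q) - G x) \<le> 1 / (2 * C\<^sup>2)"
      using d(2)[of "chart_map \<kappa> q"] q(2) by (simp add: dist_commute[of x] less_imp_le flip: dist_norm)
    then have "norm (G (chart_map \<kappa> q) - G x) * norm (v \<kappa>) * norm (v \<kappa>) \<le> 1 / (2 * C\<^sup>2) * norm (v \<kappa>) * norm (v \<kappa>)"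
      by (intro mult_right_mono) auto
    moreover have "\<bar>(G (chart_map \<kappa> q) - G x) (v \<kappa>) (v \<kappa>)\<bar> \<le> norm (G (chart_map \<kappa> q) - G x) * norm (v \<kappa>) * norm (v \<kappa>)"
      using norm_blinfun[of "(G (chart_map \<kappa> q) - G x) (v \<kappa>)" "v \<kappa>"]
        mult_right_mono[OF norm_blinfun[of "G (chart_map \<kappa> q) - G x" "v \<kappa>"] norm_ge_zero[of "v \<kappa>"]] by simp
    moreover have "(G (chart_map \<kappa> q) - G x) (v \<kappa>) (v \<kappa>) = g q v v - B (v \<kappa>) (v \<kappa>)"
      using g[OF q(1) v v] by (simp add: blinfun.diff_left B_def)
    moreover have "1 / (2 * C\<^sup>2) * norm (v \<kappa>) * norm (v \<kappa>) \<le> B (v \<kappa>) (v \<kappa>) / 2"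
      using coercive[of "v \<kappa>"] C(1) by (simp add: power2_eq_square field_simps)
    ultimately have *: "\<bar>g q v v - B (v \<kappa>) (v \<kappa>)\<bar> \<le> B (v \<kappa>) (v \<kappa>) / 2"
      by linarith
    have "B (v \<kappa>) (v \<kappa>) \<le> 4 * g q v v" "g q v v \<le> 4 * B (v \<kappa>) (v \<kappa>)"
      using * B.B_self_nonneg[of "v \<kappa>"] by linarith+
    from real_sqrt_le_mono[OF this(1)] real_sqrt_le_mono[OF this(2)]
    show "B.N (v \<kappa>) \<le> 2 * tangent_norm g q v" "tangent_norm g q v \<le> 2 * B.N (v \<kappa>)"
      by (simp_all add: B.N_def tangent_norm_def real_sqrt_mult)
  qed (use \<kappa> in auto)
  then show ?thesis
    using that \<kappa>(2) d(1) by (simp add: x_def)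
qed

end

section \<open>Coordinate segments and the Riemannian distance\<close>

lemma continuous_map_concat:
  fixes c s :: "real \<Rightarrow> 'm"
  assumes c: "continuous_map (top_of_set {a..b}) X c" and s: "continuous_map (top_of_set {b..d}) X s"
    and "c b = s b" and "a \<le> b" "b \<le> d"
  shows "continuous_map (top_of_set {a..d}) X (\<lambda>t. if t \<le> b then c t else s t)"
  unfolding continuous_map_closedin
proof (intro conjI ballI allI impI Pi_I)
  fix t assume "t \<in> topspace (top_of_set {a..d})"
  then show "(if t \<le> b then c t else s t) \<in> topspace X"
    using continuous_map_image_subset_topspace[OF c] continuous_map_image_subset_topspace[OF s] by auto
next
  fix C assume C: "closedin X C"
  have "closedin (top_of_set {a..b}) {t \<in> topspace (top_of_set {a..b}). c t \<in> C}"
    "closedin (top_of_set {b..d}) {t \<in> topspace (top_of_set {b..d}). s t \<in> C}"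
    using c s C by (auto simp: continuous_map_closedin)
  then have "closed {t \<in> {a..b}. c t \<in> C}" "closed {t \<in> {b..d}. s t \<in> C}"
    by (auto simp: closedin_closed_eq)
  then have "closed ({t \<in> {a..b}. c t \<in> C} \<union> {t \<in> {b..d}. s t \<in> C})"
    by (rule closed_Un)
  moreover have "{t \<in> topspace (top_of_set {a..d}). (if t \<le> b then c t else s t) \<in> C}
      = {t \<in> {a..b}. c t \<in> C} \<union> {t \<in> {b..d}. s t \<in> C}"
    using assms(3-5) by (auto split: if_splits)
  ultimately show "closedin (top_of_set {a..d}) {t \<in> topspace (top_of_set {a..d}). (if t \<le> b then c t else s t) \<in> C}"
    using assms(4,5) by (auto intro: closed_subset)
qed

lemma C1_curve_cong:
  assumes "C1_curve X \<A> s t c" and eq: "\<And>\<tau>. \<tau> \<in> {s..t} \<Longrightarrow> c' \<tau> = c \<tau>"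
  shows "C1_curve X \<A> s t c'"
  unfolding C1_curve_def
proof (intro conjI ballI)
  show "continuous_map (top_of_set {s..t}) X c'"
    by (rule continuous_map_eq[of _ _ c]) (use assms in \<open>auto simp: C1_curve_def\<close>)
  fix \<kappa> assume "\<kappa> \<in> \<A>"
  then obtain w where w: "continuous_on {\<tau>\<in>{s..t}. c \<tau> \<in> chart_dom \<kappa>} w"
    "\<And>\<tau>. \<tau> \<in> {s..t} \<Longrightarrow> c \<tau> \<in> chart_dom \<kappa> \<Longrightarrow>
      (chart_map \<kappa> \<circ> c has_vector_derivative w \<tau>) (at \<tau> within {s..t})"
    using assms(1) unfolding C1_curve_def by blast
  have "{\<tau>\<in>{s..t}. c' \<tau> \<in> chart_dom \<kappa>} = {\<tau>\<in>{s..t}. c \<tau> \<in> chart_dom \<kappa>}"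
    using eq by auto
  moreover have "(chart_map \<kappa> \<circ> c' has_vector_derivative w \<tau>) (at \<tau> within {s..t})"
    if "\<tau> \<in> {s..t}" "c' \<tau> \<in> chart_dom \<kappa>" for \<tau>
    by (rule has_vector_derivative_transform[OF that(1) _ w(2)]) (use that eq in auto)
  ultimately show "\<exists>w. continuous_on {\<tau>\<in>{s..t}. c' \<tau> \<in> chart_dom \<kappa>} w \<and>
        (\<forall>\<tau>\<in>{s..t}. c' \<tau> \<in> chart_dom \<kappa> \<longrightarrow>
           (chart_map \<kappa> \<circ> c' has_vector_derivative w \<tau>) (at \<tau> within {s..t}))"
    using w(1) by (intro exI[of _ w]) simp
qed

lemma piecewise_C1_path_of_curve:
  assumes "a < b" "C1_curve X \<A> a b c"
  shows "piecewise_C1_path X \<A> a b c"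
  unfolding piecewise_C1_path_def
  by (intro conjI exI[of _ 1] exI[of _ "\<lambda>i. if i = 0 then a else b"])
    (use assms in \<open>auto simp: C1_curve_def\<close>)

lemma piecewise_C1_path_concat:
  assumes c: "piecewise_C1_path X \<A> a b c" and s: "C1_curve X \<A> b d s" and "b < d" and cs: "c b = s b"
  shows "piecewise_C1_path X \<A> a d (\<lambda>t. if t \<le> b then c t else s t)"
proof -
  obtain n \<tau> where \<tau>: "\<tau> 0 = a" "\<tau> n = b"
    "\<And>i. i < n \<Longrightarrow> \<tau> i < \<tau> (Suc i) \<and> C1_curve X \<A> (\<tau> i) (\<tau> (Suc i)) c"
    and "a < b" and cont: "continuous_map (top_of_set {a..b}) X c"
    using c unfolding piecewise_C1_path_def by blast
  have le_b: "\<tau> i \<le> b" if "i \<le> n" for i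
    using that
  proof (induction i rule: inc_induct)
    case base
    then show ?case using \<tau>(2) by simp
  next
    case (step i)
    then show ?case using \<tau>(3)[of i] by simp
  qed
  define \<sigma> where "\<sigma> i = (if i \<le> n then \<tau> i else d)" for i
  have "\<sigma> i < \<sigma> (Suc i) \<and> C1_curve X \<A> (\<sigma> i) (\<sigma> (Suc i)) (\<lambda>t. if t \<le> b then c t else s t)"
    if "i < Suc n" for i
  proof (cases "i = n")
    case True
    have "C1_curve X \<A> b d (\<lambda>t. if t \<le> b then c t else s t)"
      by (rule C1_curve_cong[OF s]) (use cs in \<open>auto intro: antisym\<close>)
    then show ?thesis
      using True \<tau>(2) \<open>b < d\<close> by (simp add: \<sigma>_def)
  next
    case False
    then have i: "i < n"
      using that by simp
    have "C1_curve X \<A> (\<tau> i) (\<tau> (Suc i)) (\<lambda>t. if t \<le> b then c t else s t)"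
      by (rule C1_curve_cong[of _ _ _ _ c]) (use \<tau>(3)[OF i] le_b[of "Suc i"] i in auto)
    then show ?thesis
      using \<tau>(3)[OF i] i by (simp add: \<sigma>_def)
  qed
  moreover have "continuous_map (top_of_set {a..d}) X (\<lambda>t. if t \<le> b then c t else s t)"
    using cont s cs \<open>a < b\<close> \<open>b < d\<close> by (intro continuous_map_concat) (auto simp: C1_curve_def)
  ultimately show ?thesis
    unfolding piecewise_C1_path_def using \<open>a < b\<close> \<open>b < d\<close> \<tau>(1)
    by (intro conjI exI[of _ "Suc n"] exI[of _ \<sigma>]) (auto simp: \<sigma>_def)
qed

lemma velocity_cong:
  fixes \<A> :: "('m, 'e::{real_inner, banach}) chart set"
  assumes "open U" "t \<in> U" "\<And>\<tau>. \<tau> \<in> U \<Longrightarrow> c \<tau> = c' \<tau>"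
  shows "velocity \<A> c t = velocity \<A> c' t"
proof -
  have "vector_derivative (chart_map \<kappa> \<circ> c) (at t) = vector_derivative (chart_map \<kappa> \<circ> c') (at t)" for \<kappa> :: "('m, 'e) chart"
  proof (rule vector_derivative_cong_eq)
    show "\<forall>\<^sub>F x in nhds t. x \<in> UNIV \<longrightarrow> (chart_map \<kappa> \<circ> c) x = (chart_map \<kappa> \<circ> c') x"
      using eventually_nhds_in_open[OF assms(1,2)] by eventually_elim (simp add: assms(3))
  qed auto
  then show ?thesis
    unfolding velocity_def by (simp only: assms(3)[OF assms(2)])
qed

text \<open>
  No integrability of the speed of \<open>c\<close> is needed: if it fails, both lengths involving \<open>c\<close> are \<open>0\<close>.
\<close>

lemma path_length_concat_le:
  assumes "a \<le> b" "b \<le> d"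
    and s: "(\<lambda>t. tangent_norm g (s t) (velocity \<A> s t)) integrable_on {b..d}"
    and K: "path_length \<A> g b d s \<le> K" "0 \<le> K"
  shows "path_length \<A> g a d (\<lambda>t. if t \<le> b then c t else s t) \<le> path_length \<A> g a b c + K"
proof -
  let ?p = "\<lambda>t. if t \<le> b then c t else s t"
  define h where "h t = tangent_norm g (?p t) (velocity \<A> ?p t)" for t
  define hc where "hc t = tangent_norm g (c t) (velocity \<A> c t)" for t
  define hs where "hs t = tangent_norm g (s t) (velocity \<A> s t)" for t
  \<comment> \<open>Velocities are two-sided derivatives, so at the junction \<open>b\<close> the
    concatenation may have a velocity unrelated to that of \<open>c\<close>. The integrals ignore
    finitely many points.\<close>
  have h_c: "h t = hc t" if "t \<in> {a..b} - {a, b}" for t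
  proof -
    have "velocity \<A> ?p t = velocity \<A> c t"
      by (rule velocity_cong[where U = "{..<b}"]) (use that in auto)
    then show ?thesis
      using that by (simp add: h_def hc_def)
  qed
  have h_s: "h t = hs t" if "t \<in> {b..d} - {b, d}" for t
  proof -
    have "velocity \<A> ?p t = velocity \<A> s t"
      by (rule velocity_cong[where U = "{b<..}"]) (use that in auto)
    then show ?thesis
      using that by (simp add: h_def hs_def)
  qed
  show ?thesis
  proof (cases "hc integrable_on {a..b}")
    case True
    then have 1: "h integrable_on {a..b}"
      by (rule integrable_spike_finite[where S = "{a, b}", OF _ h_c, rotated 2]) auto
    have "hs integrable_on {b..d}"
      using s by (simp add: hs_def[abs_def])
    then have 2: "h integrable_on {b..d}"
      by (rule integrable_spike_finite[where S = "{b, d}", OF _ h_s, rotated 2]) auto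
    have "integral {a..d} h = integral {a..b} h + integral {b..d} h"
      using Henstock_Kurzweil_Integration.integral_combine[OF assms(1,2) Henstock_Kurzweil_Integration.integrable_combine[OF assms(1,2) 1 2]] by simp
    also have "integral {a..b} h = integral {a..b} hc"
      by (rule integral_spike[where S = "{a, b}", OF _ h_c[symmetric]]) auto
    also have "integral {b..d} h = integral {b..d} hs"
      by (rule integral_spike[where S = "{b, d}", OF _ h_s[symmetric]]) auto
    finally show ?thesis
      using K by (simp add: path_length_def h_def[abs_def] hc_def[abs_def] hs_def[abs_def])
  next
    case False
    have "\<not> h integrable_on {a..d}"
    proof
      assume "h integrable_on {a..d}"
      then have "h integrable_on {a..b}"
        by (rule integrable_on_subinterval) (use assms in auto)
      then have "hc integrable_on {a..b}"
        by (rule integrable_spike_finite[where S = "{a, b}", OF _ h_c[symmetric], rotated 2]) auto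
      with False show False ..
    qed
    with False show ?thesis
      using K by (simp add: path_length_def h_def[abs_def] hc_def[abs_def] not_integrable_integral)
  qed
qed

section \<open>Coordinate segments as competitors for the distance\<close>

context riemannian_manifold
begin

text \<open>In the chart \<open>\<kappa>\<close> the curve is affine, with constant velocity
  \<open>y - x\<close>; its formula makes sense beyond the interval, so two-sided derivatives exist
  at the endpoints as well. Starting at time \<open>b\<close> allows it to be appended to a path
  that ends then.\<close>

lemma segment_curve:
  fixes b :: real
  assumes ne: "near_euclidean \<kappa> B S" and x: "x \<in> S" and y: "y \<in> S"
  defines "c \<equiv> \<lambda>t. chart_inv \<kappa> (x + (t - b) *\<^sub>R (y - x))"
  shows "C1_curve X \<A> b (b + 1) c"
    and "(\<lambda>t. tangent_norm g (c t) (velocity \<A> c t)) integrable_on {b..b + 1}"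
    and "path_length \<A> g b (b + 1) c \<le> 2 * equivalent_inner.N B (y - x)"
proof -
  have \<kappa>: "\<kappa> \<in> \<A>" and S: "open S" "convex S" "S \<subseteq> image_of \<kappa>"
    and metric: "\<And>q v. q \<in> chart_dom \<kappa> \<Longrightarrow> chart_map \<kappa> q \<in> S \<Longrightarrow> v \<in> tangent_space \<A> q \<Longrightarrow>
        tangent_norm g q v \<le> 2 * equivalent_inner.N B (v \<kappa>)"
    using ne unfolding near_euclidean_def by auto
  define l where "l t = x + (t - b) *\<^sub>R (y - x)" for t
  have l_S: "l t \<in> S" if "t \<in> {b..b + 1}" for t
    using convexD_alt[OF S(2) x y, of "t - b"] that by (simp add: l_def algebra_simps)
  then have c_dom: "c t \<in> chart_dom \<kappa>" and c_map: "chart_map \<kappa> (c t) = l t" if "t \<in> {b..b + 1}" for t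
    using S(3) that by (auto simp: c_def l_def intro!: chart_inv_in_dom chart_map_chart_inv)
  have l_deriv: "(l has_vector_derivative y - x) (at t within T)" for t T
    unfolding l_def by (auto intro!: derivative_eq_intros)
  have l_cont: "continuous_on T l" for T
    unfolding l_def by (intro continuous_intros)

  have deriv: "(chart_map \<mu> \<circ> c has_vector_derivative
      frechet_derivative (transition \<kappa> \<mu>) (at (l t)) (y - x)) (at t)"
    if "t \<in> {b..b + 1}" "\<mu> \<in> \<A>" "c t \<in> chart_dom \<mu>" for t \<mu>
  proof -
    have "(transition \<kappa> \<mu> has_derivative frechet_derivative (transition \<kappa> \<mu>) (at (l t))) (at (l t))"
      using transition_has_derivative[of \<kappa> "c t" \<mu>] c_dom[OF that(1)] c_map[OF that(1)] that \<kappa>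
      by (simp add: charts_at_def)
    from vector_derivative_diff_chain_within[OF l_deriv has_derivative_at_withinI[OF this]]
    have "(transition \<kappa> \<mu> \<circ> l has_vector_derivative
      frechet_derivative (transition \<kappa> \<mu>) (at (l t)) (y - x)) (at t)" .
    moreover have "transition \<kappa> \<mu> \<circ> l = chart_map \<mu> \<circ> c"
      by (simp add: fun_eq_iff c_def l_def)
    ultimately show ?thesis by simp
  qed

  show "C1_curve X \<A> b (b + 1) c"
    unfolding C1_curve_def
  proof (intro conjI ballI)
    have "continuous_map (top_of_set {b..b + 1}) (top_of_set (image_of \<kappa>)) l"
      using l_cont l_S S(3) by (auto simp: continuous_map_in_subtopology)
    moreover have "continuous_map (top_of_set (image_of \<kappa>)) X (chart_inv \<kappa>)"
      using continuous_chart_inv[OF \<kappa>] continuous_map_into_fulltopology by blast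
    ultimately have "continuous_map (top_of_set {b..b + 1}) X (chart_inv \<kappa> \<circ> l)"
      by (rule continuous_map_compose)
    then show "continuous_map (top_of_set {b..b + 1}) X c"
      by (simp add: c_def l_def comp_def)
  next
    fix \<mu> assume \<mu>: "\<mu> \<in> \<A>"
    let ?w = "\<lambda>\<tau>. blinfun_apply (Blinfun (frechet_derivative (transition \<kappa> \<mu>) (at (l \<tau>)))) (y - x)"
    have "continuous_on (chart_map \<kappa> ` (chart_dom \<kappa> \<inter> chart_dom \<mu>))
        (\<lambda>z. Blinfun (frechet_derivative (transition \<kappa> \<mu>) (at z)))"
      using transition_C1[OF \<kappa> \<mu>] by (simp add: C1_on_iff_frechet)
    moreover have "l ` {\<tau> \<in> {b..b + 1}. c \<tau> \<in> chart_dom \<mu>} \<subseteq> chart_map \<kappa> ` (chart_dom \<kappa> \<inter> chart_dom \<mu>)"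
    proof (rule image_subsetI)
      fix t assume "t \<in> {\<tau> \<in> {b..b + 1}. c \<tau> \<in> chart_dom \<mu>}"
      then have t: "t \<in> {b..b + 1}" "c t \<in> chart_dom \<mu>"
        by auto
      show "l t \<in> chart_map \<kappa> ` (chart_dom \<kappa> \<inter> chart_dom \<mu>)"
        by (rule image_eqI[of _ _ "c t"]) (use t c_dom[OF t(1)] c_map[OF t(1)] in auto)
    qed
    ultimately have "continuous_on {\<tau> \<in> {b..b + 1}. c \<tau> \<in> chart_dom \<mu>} ?w"
      by (intro continuous_intros
          continuous_on_compose2[of _ "\<lambda>z. Blinfun (frechet_derivative (transition \<kappa> \<mu>) (at z))" _ l] l_cont)
    moreover have "(chart_map \<mu> \<circ> c has_vector_derivative ?w \<tau>) (at \<tau> within {b..b + 1})"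
      if \<tau>: "\<tau> \<in> {b..b + 1}" "c \<tau> \<in> chart_dom \<mu>" for \<tau>
    proof -
      have "bounded_linear (frechet_derivative (transition \<kappa> \<mu>) (at (l \<tau>)))"
        using transition_has_derivative[of \<kappa> "c \<tau>" \<mu>] c_dom[OF \<tau>(1)] c_map[OF \<tau>(1)] \<tau> \<kappa> \<mu>
        by (simp add: charts_at_def has_derivative_bounded_linear)
      then show ?thesis
        using deriv[OF \<tau>(1) \<mu> \<tau>(2)] by (simp add: bounded_linear_Blinfun_apply has_vector_derivative_at_within)
    qed
    ultimately show "\<exists>w. continuous_on {\<tau> \<in> {b..b + 1}. c \<tau> \<in> chart_dom \<mu>} w \<and>
        (\<forall>\<tau>\<in>{b..b + 1}. c \<tau> \<in> chart_dom \<mu> \<longrightarrow>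
           (chart_map \<mu> \<circ> c has_vector_derivative w \<tau>) (at \<tau> within {b..b + 1}))"
      by blast
  qed

  have vel: "velocity \<A> c t \<in> tangent_space \<A> (c t)" "velocity \<A> c t \<kappa> = y - x" if t: "t \<in> {b..b + 1}" for t
  proof -
    have at: "\<kappa> \<in> charts_at \<A> (c t)"
      using \<kappa> c_dom[OF t] by (simp add: charts_at_def)
    have eq: "velocity \<A> c t = (\<lambda>\<mu>. if \<mu> \<in> charts_at \<A> (c t)
        then frechet_derivative (transition \<kappa> \<mu>) (at (chart_map \<kappa> (c t))) (y - x) else 0)"
      unfolding velocity_def
      by (intro ext if_cong refl, subst vector_derivative_at[OF deriv[OF t]])
        (use t in \<open>auto simp: charts_at_def c_map\<close>)
    show "velocity \<A> c t \<in> tangent_space \<A> (c t)"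
      unfolding eq by (rule tangent_vector_of_coordinates[OF at])
    show "velocity \<A> c t \<kappa> = y - x"
      unfolding eq using at by (simp add: transition_self_derivative)
  qed

  obtain G :: "'e \<Rightarrow> 'e \<Rightarrow>\<^sub>L 'e \<Rightarrow>\<^sub>L real" where G: "continuous_on (image_of \<kappa>) G"
    and g: "\<And>p v w. p \<in> chart_dom \<kappa> \<Longrightarrow> v \<in> tangent_space \<A> p \<Longrightarrow> w \<in> tangent_space \<A> p \<Longrightarrow>
      g p v w = G (chart_map \<kappa> p) (v \<kappa>) (w \<kappa>)"
    using metric_in_chart[OF \<kappa>] by blast
  have "continuous_on {b..b + 1} (\<lambda>t. sqrt (G (l t) (y - x) (y - x)))"
    by (intro continuous_intros continuous_on_compose2[OF G l_cont]) (use l_S S(3) in auto)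
  then have "continuous_on {b..b + 1} (\<lambda>t. tangent_norm g (c t) (velocity \<A> c t))"
    by (rule continuous_on_eq) (simp add: tangent_norm_def g[OF c_dom vel(1) vel(1)] vel(2) c_map)
  then show int: "(\<lambda>t. tangent_norm g (c t) (velocity \<A> c t)) integrable_on {b..b + 1}"
    by (rule integrable_continuous_real)
  have "integral {b..b + 1} (\<lambda>t. tangent_norm g (c t) (velocity \<A> c t))
      \<le> integral {b..b + 1} (\<lambda>t. 2 * equivalent_inner.N B (y - x))"
  proof (rule integral_le[OF int])
    fix t assume t: "t \<in> {b..b + 1}"
    then show "tangent_norm g (c t) (velocity \<A> c t) \<le> 2 * equivalent_inner.N B (y - x)"
      using metric[OF c_dom[OF t] _ vel(1)[OF t]] by (simp add: c_map l_S vel(2))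
  qed (rule integrable_const_ivl)
  then show "path_length \<A> g b (b + 1) c \<le> 2 * equivalent_inner.N B (y - x)"
    by (simp add: path_length_def)
qed

text \<open>Paths must have \<open>a < b\<close>, so the witness is a degenerate coordinate segment
  on the unit interval.\<close>

lemma riemannian_dist_self_le:
  assumes "p \<in> topspace X"
  shows "riemannian_dist X \<A> g p p \<le> 0"
proof -
  obtain \<kappa> B S where ne: "near_euclidean \<kappa> B S" and p: "p \<in> chart_dom \<kappa>" "chart_map \<kappa> p \<in> S"
    using ex_near_euclidean[OF assms] .
  have \<kappa>: "\<kappa> \<in> \<A>"
    using ne by (simp add: near_euclidean_def)
  interpret equivalent_inner B
    using ne by (simp add: near_euclidean_def)
  let ?x = "chart_map \<kappa> p"
  let ?c = "\<lambda>t. chart_inv \<kappa> (?x + (t - 0) *\<^sub>R (?x - ?x))"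
  note segment_curve[OF ne p(2) p(2), of 0]
  then have "piecewise_C1_path X \<A> 0 (0 + 1) ?c" "path_length \<A> g 0 (0 + 1) ?c \<le> 0"
    by (auto intro: piecewise_C1_path_of_curve)
  moreover have "?c 0 = p" "?c (0 + 1) = p"
    using \<kappa> p by auto
  ultimately have "riemannian_dist X \<A> g p p \<le> ereal (path_length \<A> g 0 (0 + 1) ?c)"
    unfolding riemannian_dist_def by (intro Inf_lower) blast
  also have "\<dots> \<le> 0"
    using \<open>path_length \<A> g 0 (0 + 1) ?c \<le> 0\<close> by simp
  finally show ?thesis .
qed

text \<open>Every competitor from \<open>p\<close> to \<open>q\<close> is prolonged by the
  coordinate segment from \<open>q\<close> to \<open>q'\<close>, whose length is at most twice its
  length in the norm of \<open>B\<close>.\<close>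

lemma riemannian_dist_chart_le:
  assumes ne: "near_euclidean \<kappa> B S"
    and q: "q \<in> chart_dom \<kappa>" "chart_map \<kappa> q \<in> S" and q': "q' \<in> chart_dom \<kappa>" "chart_map \<kappa> q' \<in> S"
  shows "riemannian_dist X \<A> g p q' \<le>
    riemannian_dist X \<A> g p q + ereal (2 * equivalent_inner.N B (chart_map \<kappa> q' - chart_map \<kappa> q))"
proof -
  have \<kappa>: "\<kappa> \<in> \<A>"
    using ne by (simp add: near_euclidean_def)
  interpret equivalent_inner B
    using ne by (simp add: near_euclidean_def)
  define K where "K = 2 * N (chart_map \<kappa> q' - chart_map \<kappa> q)"
  \<comment> \<open>With the finite \<open>K\<close> moved to the left, the left side is a lower
    bound independent of the path. The case without any path, where the infimum is infinite, is
    included.\<close>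
  have "riemannian_dist X \<A> g p q' - ereal K \<le> riemannian_dist X \<A> g p q"
    unfolding riemannian_dist_def[of X \<A> g p q]
  proof (rule Inf_greatest, clarify)
    fix a b c assume c: "piecewise_C1_path X \<A> a b c" and ends: "p = c a" "q = c b"
    define s where "s t = chart_inv \<kappa> (chart_map \<kappa> q + (t - b) *\<^sub>R (chart_map \<kappa> q' - chart_map \<kappa> q))" for t
    note seg = segment_curve[OF ne q(2) q'(2), of b, folded s_def K_def]
    have s_ends: "s b = q" "s (b + 1) = q'"
      using q q' \<kappa> by (simp_all add: s_def)
    have ab: "a < b"
      using c by (simp add: piecewise_C1_path_def)
    let ?p = "\<lambda>t. if t \<le> b then c t else s t"
    have "piecewise_C1_path X \<A> a (b + 1) ?p"
      by (rule piecewise_C1_path_concat[OF c seg(1)]) (use s_ends ends in auto)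
    then have "riemannian_dist X \<A> g p q' \<le> ereal (path_length \<A> g a (b + 1) ?p)"
      unfolding riemannian_dist_def using ab ends s_ends
      by (intro Inf_lower CollectI exI[of _ a] exI[of _ "b + 1"] exI[of _ ?p]) auto
    also have "\<dots> \<le> ereal (path_length \<A> g a b c + K)"
      using ab seg(2,3) by (intro ereal_less_eq(3)[THEN iffD2] path_length_concat_le) (auto simp: K_def)
    finally have "riemannian_dist X \<A> g p q' \<le> ereal (path_length \<A> g a b c) + ereal K"
      by simp
    then show "riemannian_dist X \<A> g (c a) q' - ereal K \<le> ereal (path_length \<A> g a b c)"
      using ends(1) by (simp add: ereal_minus_le)
  qed
  then show ?thesis
    by (simp add: K_def ereal_minus_le)
qed

end

section \<open>Local approximation\<close>

context hilbert_manifold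
begin

lemma locally_finite_refinement:
  assumes "\<And>U. U \<in> \<U> \<Longrightarrow> openin X U" "\<Union>\<U> = topspace X"
  shows "\<exists>\<V>. (\<forall>V\<in>\<V>. openin X V) \<and> \<Union>\<V> = topspace X \<and> (\<forall>V\<in>\<V>. \<exists>U\<in>\<U>. V \<subseteq> U) \<and> locally_finite_in X \<V>"
proof -
  have "(\<forall>U\<in>\<U>. openin X U) \<and> \<Union>\<U> = topspace X"
    using assms by blast
  from paracompact[unfolded paracompact_space_def, THEN spec, THEN mp, OF this]
  show ?thesis .
qed

text \<open>Cover the space by open sets that lie in \<open>U\<close> or are separated from
  \<open>p\<close> by a neighbourhood of \<open>p\<close>, and refine. Near \<open>p\<close> only
  finitely many members of the refinement fail to lie in \<open>U\<close>, and none of these has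
  \<open>p\<close> in its closure.\<close>

lemma regular:
  assumes U: "openin X U" and p: "p \<in> U"
  obtains V where "openin X V" "p \<in> V" "X closure_of V \<subseteq> U"
proof -
  have p_top: "p \<in> topspace X"
    using U p openin_subset by blast
  define \<U> where "\<U> = {W. openin X W \<and> (W \<subseteq> U \<or> (\<exists>A. openin X A \<and> p \<in> A \<and> A \<inter> W = {}))}"
  have "\<exists>W\<in>\<U>. x \<in> W" if x: "x \<in> topspace X" for x
  proof (cases "x \<in> U")
    case True
    then show ?thesis
      using U by (auto simp: \<U>_def)
  next
    case False
    then have "p \<noteq> x"
      using p by blast
    then obtain A W where "openin X A" "openin X W" "p \<in> A" "x \<in> W" "disjnt A W"
      using hausdorff p_top x unfolding Hausdorff_space_def by blast
    then show ?thesis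
      by (auto simp: \<U>_def disjnt_def)
  qed
  moreover have \<U>_open: "openin X U" if "U \<in> \<U>" for U
    using that by (simp add: \<U>_def)
  ultimately have "\<Union>\<U> = topspace X"
    using openin_subset by blast
  obtain \<V> where \<V>: "\<forall>V\<in>\<V>. openin X V" "\<Union>\<V> = topspace X" "\<forall>V\<in>\<V>. \<exists>W\<in>\<U>. V \<subseteq> W" "locally_finite_in X \<V>"
    using locally_finite_refinement[OF \<U>_open \<open>\<Union>\<U> = topspace X\<close>] by blast
  obtain N where N: "openin X N" "p \<in> N" "finite {V \<in> \<V>. V \<inter> N \<noteq> {}}"
    using \<V>(4) p_top unfolding locally_finite_in_def by blast
  define F where "F = {V \<in> \<V>. V \<inter> N \<noteq> {} \<and> \<not> V \<subseteq> U}"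
  have "finite F"
    unfolding F_def by (rule finite_subset[OF _ N(3)]) auto
  have not_closure: "p \<notin> X closure_of V" if V: "V \<in> F" for V
  proof -
    have "V \<in> \<V>" "\<not> V \<subseteq> U"
      using V by (simp_all add: F_def)
    obtain W where W: "W \<in> \<U>" "V \<subseteq> W"
      using bspec[OF \<V>(3) \<open>V \<in> \<V>\<close>] by blast
    then have "\<not> W \<subseteq> U"
      using \<open>\<not> V \<subseteq> U\<close> by blast
    then obtain A where "openin X A" "p \<in> A" "A \<inter> W = {}"
      using W(1) by (auto simp: \<U>_def)
    with W(2) have "openin X A" "p \<in> A" "A \<inter> V = {}"
      by auto
    then show ?thesis
      unfolding in_closure_of by blast
  qed
  show thesis
  proof
    show "openin X (N - \<Union>((closure_of) X ` F))"
      using N(1) \<open>finite F\<close> by (intro openin_diff closedin_Union) auto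
    show "p \<in> N - \<Union>((closure_of) X ` F)"
      using N(2) not_closure by blast
    \<comment> \<open>The right side is closed, and since the refinement covers the space it
      consists of points covered by members inside \<open>U\<close>.\<close>
    have "X closure_of (N - \<Union>((closure_of) X ` F)) \<subseteq> topspace X - \<Union>{V \<in> \<V>. \<not> V \<subseteq> U}"
    proof (rule closure_of_minimal)
      show "N - \<Union>((closure_of) X ` F) \<subseteq> topspace X - \<Union>{V \<in> \<V>. \<not> V \<subseteq> U}"
      proof
        fix x assume x: "x \<in> N - \<Union>((closure_of) X ` F)"
        have "x \<notin> V" if V: "V \<in> \<V>" "\<not> V \<subseteq> U" for V
        proof
          assume "x \<in> V"
          then have "V \<in> F"
            using V x by (auto simp: F_def)
          moreover have "x \<in> X closure_of V"
            using \<open>x \<in> V\<close> closure_of_subset[OF openin_subset[OF \<V>(1)[rule_format, OF V(1)]]] by blast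
          ultimately show False
            using x by blast
        qed
        then show "x \<in> topspace X - \<Union>{V \<in> \<V>. \<not> V \<subseteq> U}"
          using x openin_subset[OF N(1)] by blast
      qed
      show "closedin X (topspace X - \<Union>{V \<in> \<V>. \<not> V \<subseteq> U})"
        using \<V>(1) by (intro closedin_diff closedin_topspace openin_Union) auto
    qed
    then show "X closure_of (N - \<Union>((closure_of) X ` F)) \<subseteq> U"
      using \<V>(2) by blast
  qed
qed

end

section \<open>Lipschitz functions for the norm of an inner product\<close>

context equivalent_inner
begin

lemma derivative_bound:
  fixes k :: "'e \<Rightarrow> real"
  assumes k: "(k has_derivative k') (at x)" and L: "\<And>x y. k x - k y \<le> L * N (x - y)"
  shows "\<bar>k' v\<bar> \<le> L * N v"
proof -
  have lin: "linear k'"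
    using k has_derivative_linear by blast
  have "((\<lambda>t. k (x + t *\<^sub>R v)) has_derivative (\<lambda>t. k' (t *\<^sub>R v))) (at 0)"
    by (rule has_derivative_compose[of "\<lambda>t. x + t *\<^sub>R v" "\<lambda>t. t *\<^sub>R v"])
      (auto intro!: derivative_eq_intros simp: k)
  then have "((\<lambda>t. k (x + t *\<^sub>R v)) has_real_derivative k' v) (at 0)"
    by (simp add: has_field_derivative_def linear_cmul[OF lin] mult_commute_abs)
  then have lim: "((\<lambda>t. \<bar>(k (x + t *\<^sub>R v) - k x) / t\<bar>) \<longlongrightarrow> \<bar>k' v\<bar>) (at 0)"
    by (intro tendsto_rabs) (simp add: DERIV_def)
  have "\<bar>(k (x + t *\<^sub>R v) - k x) / t\<bar> \<le> L * N v" if "t \<noteq> 0" for t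
  proof -
    have "N (t *\<^sub>R v) = \<bar>t\<bar> * N v" "N (- (t *\<^sub>R v)) = \<bar>t\<bar> * N v"
      using N_scale[of t v] N_scale[of "- t" v] by auto
    then have "\<bar>k (x + t *\<^sub>R v) - k x\<bar> \<le> \<bar>t\<bar> * (L * N v)"
      using L[of "x + t *\<^sub>R v" x] L[of x "x + t *\<^sub>R v"] by (simp add: abs_le_iff mult_ac)
    then show ?thesis
      using that by (simp add: pos_divide_le_eq mult.commute)
  qed
  then have "\<forall>\<^sub>F t in at 0. \<bar>(k (x + t *\<^sub>R v) - k x) / t\<bar> \<le> L * N v"
    unfolding eventually_at_filter by (intro always_eventually) simp
  with lim show ?thesis
    by (rule tendsto_upperbound) simp
qed

text \<open>Regularization requires a function on the whole model space, while the distance is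
  controlled only within a patch. The infimum of the cones with vertices on the graph extends it
  with the same constant.\<close>

lemma McShane_extension:
  fixes f :: "'e \<Rightarrow> real"
  assumes "S \<noteq> {}" and f: "\<And>x y. x \<in> S \<Longrightarrow> y \<in> S \<Longrightarrow> f x \<le> f y + L * N (x - y)" and "0 \<le> L"
  obtains u where "\<And>x. x \<in> S \<Longrightarrow> u x = f x" "\<And>x y. u x - u y \<le> L * N (x - y)"
proof
  define u where "u z = (INF x\<in>S. f x + L * N (z - x))" for z
  have tri: "L * N (z - x) \<le> L * N (z - y) + L * N (y - x)" for x y z
    using N_triangle_minus[of z x y] \<open>0 \<le> L\<close> by (simp add: mult_left_mono flip: distrib_left)
  obtain x0 where x0: "x0 \<in> S"
    using \<open>S \<noteq> {}\<close> by blast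
  have "bdd_below ((\<lambda>x. f x + L * N (z - x)) ` S)" for z
  proof (rule bdd_belowI2)
    fix x assume "x \<in> S"
    then show "f x0 - L * N (x0 - z) \<le> f x + L * N (z - x)"
      using f[OF x0, of x] tri[of x0 x z] by linarith
  qed
  then have lower: "u z \<le> f x + L * N (z - x)" if "x \<in> S" for x z
    unfolding u_def using that by (rule cINF_lower)
  have greatest: "c \<le> u z" if "\<And>x. x \<in> S \<Longrightarrow> c \<le> f x + L * N (z - x)" for c z
    unfolding u_def using \<open>S \<noteq> {}\<close> that by (rule cINF_greatest)
  show "u x = f x" if "x \<in> S" for x
    using lower[OF that, of x] greatest[of "f x" x] f[OF that] by force
  show "u x - u y \<le> L * N (x - y)" for x y
  proof -
    have "u x - L * N (x - y) \<le> u y"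
      using lower[of _ x] tri[of x _ y] by (intro greatest) (smt (verit))
    then show ?thesis by simp
  qed
qed

text \<open>The witness is the minimum of \<open>\<eta>\<close> and the distance to the complement
  of \<open>A\<close>. Inserting \<open>\<eta>\<close> into the set of distances also keeps the
  infimum meaningful when that complement is empty.\<close>

lemma truncated_distance:
  assumes "0 < \<eta>"
  obtains D where "\<And>x y. D x - D y \<le> N (x - y)" "\<And>x. 0 \<le> D x" "\<And>x. D x \<le> \<eta>"
    "\<And>x. x \<notin> A \<Longrightarrow> D x = 0" "\<And>x. (\<And>z. N (z - x) < \<eta> \<Longrightarrow> z \<in> A) \<Longrightarrow> D x = \<eta>"
proof
  define D where "D x = Inf (insert \<eta> ((\<lambda>a. N (x - a)) ` (- A)))" for x
  have bdd: "bdd_below (insert \<eta> ((\<lambda>a. N (x - a)) ` (- A)))" for x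
    using \<open>0 < \<eta>\<close> by (intro bdd_belowI[of _ 0]) auto
  have greatest: "c \<le> D x" if "c \<le> \<eta>" "\<And>a. a \<notin> A \<Longrightarrow> c \<le> N (x - a)" for c x
    unfolding D_def using that by (intro cInf_greatest) auto
  show upper: "D x \<le> \<eta>" for x
    unfolding D_def by (rule cInf_lower[OF _ bdd]) simp
  have lower: "D x \<le> N (x - a)" if "a \<notin> A" for x a
    unfolding D_def by (rule cInf_lower[OF _ bdd]) (use that in simp)
  show nonneg: "0 \<le> D x" for x
    using \<open>0 < \<eta>\<close> by (intro greatest) auto
  show "D x = 0" if "x \<notin> A" for x
    using lower[OF that, of x] nonneg[of x] by simp
  show "D x = \<eta>" if "\<And>z. N (z - x) < \<eta> \<Longrightarrow> z \<in> A" for x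
    using that N_minus_commute[of x] upper[of x] by (intro antisym greatest) (auto simp: not_less[symmetric])
  show "D x - D y \<le> N (x - y)" for x y
  proof -
    have "D x - N (x - y) \<le> D y"
    proof (rule greatest)
      show "D x - N (x - y) \<le> \<eta>"
        using upper[of x] N_nonneg[of "x - y"] by linarith
      show "D x - N (x - y) \<le> N (y - a)" if "a \<notin> A" for a
        using lower[OF that, of x] N_triangle_minus[of x a y] by linarith
    qed
    then show ?thesis by simp
  qed
qed

end

section \<open>Patches and approximation inside one patch\<close>

context riemannian_manifold
begin

definition patch :: "('m, 'e) chart \<Rightarrow> 'e set \<Rightarrow> 'm set" where
  "patch \<kappa> S = {q \<in> chart_dom \<kappa>. chart_map \<kappa> q \<in> S}"

lemma openin_patch: "near_euclidean \<kappa> B S \<Longrightarrow> openin X (patch \<kappa> S)"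
  unfolding patch_def near_euclidean_def by (intro openin_chart_preimage) auto

text \<open>Regularity first shrinks the patches. With closures inside patches, a point near which
  \<open>V\<close> matters lies in the patch of \<open>V\<close>, where the approximant is C^1; from
  any other \<open>V\<close> it can be separated by a neighbourhood.\<close>

lemma locally_finite_patch_cover:
  "\<exists>\<V>. (\<forall>V\<in>\<V>. openin X V) \<and> \<Union>\<V> = topspace X \<and> locally_finite_in X \<V> \<and>
    (\<forall>V\<in>\<V>. \<exists>\<kappa> B S. near_euclidean \<kappa> B S \<and> X closure_of V \<subseteq> patch \<kappa> S)"
proof -
  define \<U> where "\<U> = {U. openin X U \<and> (\<exists>\<kappa> B S. near_euclidean \<kappa> B S \<and> X closure_of U \<subseteq> patch \<kappa> S)}"
  have "\<exists>U\<in>\<U>. p \<in> U" if p: "p \<in> topspace X" for p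
  proof -
    obtain \<kappa> B S where ne: "near_euclidean \<kappa> B S" "p \<in> chart_dom \<kappa>" "chart_map \<kappa> p \<in> S"
      using ex_near_euclidean[OF p] .
    then have "p \<in> patch \<kappa> S"
      by (simp add: patch_def)
    then obtain U where "openin X U" "p \<in> U" "X closure_of U \<subseteq> patch \<kappa> S"
      using regular[OF openin_patch[OF ne(1)]] by blast
    then show ?thesis
      using ne(1) unfolding \<U>_def by blast
  qed
  moreover have \<U>_open: "openin X U" if "U \<in> \<U>" for U
    using that by (simp add: \<U>_def)
  ultimately have "\<Union>\<U> = topspace X"
    using openin_subset by blast
  obtain \<V> where \<V>: "\<forall>V\<in>\<V>. openin X V" "\<Union>\<V> = topspace X" "\<forall>V\<in>\<V>. \<exists>U\<in>\<U>. V \<subseteq> U" "locally_finite_in X \<V>"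
    using locally_finite_refinement[OF \<U>_open \<open>\<Union>\<U> = topspace X\<close>] by blast
  have patches: "\<exists>\<kappa> B S. near_euclidean \<kappa> B S \<and> X closure_of V \<subseteq> patch \<kappa> S" if V: "V \<in> \<V>" for V
  proof -
    obtain U where U: "U \<in> \<U>" "V \<subseteq> U"
      using bspec[OF \<V>(3) V] by blast
    then obtain \<kappa> B S where "near_euclidean \<kappa> B S" "X closure_of U \<subseteq> patch \<kappa> S"
      unfolding \<U>_def by blast
    then show ?thesis
      using closure_of_mono[OF U(2), of X] by blast
  qed
  show ?thesis
    by (intro exI[of _ \<V>] conjI ballI \<V>(2,4) patches bspec[OF \<V>(1)])
qed

text \<open>Isolates what the approximation has to know about the truncated distance. The factor 2
  is the one from \<open>riemannian_dist_chart_le\<close>.\<close>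

definition chart_lipschitz :: "('m \<Rightarrow> real) \<Rightarrow> bool" where
  "chart_lipschitz f \<longleftrightarrow> (\<forall>\<kappa> B S. near_euclidean \<kappa> B S \<longrightarrow> (\<forall>q\<in>patch \<kappa> S. \<forall>q'\<in>patch \<kappa> S.
     f q' \<le> f q + 2 * equivalent_inner.N B (chart_map \<kappa> q' - chart_map \<kappa> q)))"

text \<open>Inside \<open>V\<close> the function is raised by \<open>5 * \<eta>\<close> at depth
  \<open>\<eta>\<close>; regularization errs by \<open>\<eta>\<close>, and the result is lowered by
  \<open>\<eta>\<close>. This leaves at most \<open>f\<close> off \<open>V\<close> and at least
  \<open>f + 3 * \<eta>\<close> at depth \<open>\<eta>\<close>. The Lipschitz constant in
  \<open>N\<close> is \<open>2 + 5\<close>, and passing to the Riemannian norm doubles it to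
  14.\<close>

lemma local_approximation:
  assumes ne: "near_euclidean \<kappa> B S" and V: "V \<subseteq> patch \<kappa> S" and f: "chart_lipschitz f" and "0 < \<eta>"
  obtains G where "C1_on S (G \<circ> chart_inv \<kappa>)"
    "\<And>q. q \<in> patch \<kappa> S \<Longrightarrow> G q \<le> f q + 5 * \<eta>"
    "\<And>q. q \<notin> V \<Longrightarrow> G q \<le> f q"
    "\<And>q. q \<in> V \<Longrightarrow> (\<And>z. equivalent_inner.N B (z - chart_map \<kappa> q) < \<eta> \<Longrightarrow> z \<in> chart_map \<kappa> ` V) \<Longrightarrow>
       f q + 3 * \<eta> \<le> G q"
    "\<And>q v. q \<in> patch \<kappa> S \<Longrightarrow> v \<in> tangent_space \<A> q \<Longrightarrow>
       \<bar>frechet_derivative (G \<circ> chart_inv \<kappa>) (at (chart_map \<kappa> q)) (v \<kappa>)\<bar> \<le> 14 * tangent_norm g q v"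
proof (cases "S = {}")
  case True
  then have "patch \<kappa> S = {}"
    by (simp add: patch_def)
  then show ?thesis
    using True V by (intro that[of f]) (auto simp: C1_on_def)
next
  case False
  have \<kappa>: "\<kappa> \<in> \<A>" and S: "open S" "S \<subseteq> image_of \<kappa>"
    and metric: "\<And>q v. q \<in> patch \<kappa> S \<Longrightarrow> v \<in> tangent_space \<A> q \<Longrightarrow>
        equivalent_inner.N B (v \<kappa>) \<le> 2 * tangent_norm g q v"
    using ne unfolding near_euclidean_def patch_def by auto
  interpret equivalent_inner B
    using ne by (simp add: near_euclidean_def)
  have inv_patch: "chart_inv \<kappa> x \<in> patch \<kappa> S" "chart_map \<kappa> (chart_inv \<kappa> x) = x" if "x \<in> S" for x
    using that S(2) by (auto simp: patch_def chart_map_chart_inv chart_inv_in_dom subset_iff)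
  have "(f \<circ> chart_inv \<kappa>) x \<le> (f \<circ> chart_inv \<kappa>) y + 2 * N (x - y)" if "x \<in> S" "y \<in> S" for x y
    using f ne inv_patch[OF that(1)] inv_patch[OF that(2)] unfolding chart_lipschitz_def by fastforce
  then obtain u where u: "\<And>x. x \<in> S \<Longrightarrow> u x = (f \<circ> chart_inv \<kappa>) x" "\<And>x y. u x - u y \<le> 2 * N (x - y)"
    using McShane_extension[OF False, of "f \<circ> chart_inv \<kappa>" 2] by auto
  obtain D where D: "\<And>x y. D x - D y \<le> N (x - y)" "\<And>x. 0 \<le> D x" "\<And>x. D x \<le> \<eta>"
    "\<And>x. x \<notin> chart_map \<kappa> ` V \<Longrightarrow> D x = 0"
    "\<And>x. (\<And>z. N (z - x) < \<eta> \<Longrightarrow> z \<in> chart_map \<kappa> ` V) \<Longrightarrow> D x = \<eta>"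
    using truncated_distance[OF \<open>0 < \<eta>\<close>, of "chart_map \<kappa> ` V"] by blast
  have "(u x + 5 * D x) - (u y + 5 * D y) \<le> 7 * N (x - y)" for x y
    using u(2)[of x y] D(1)[of x y] by linarith
  then obtain k where k: "C1_on UNIV k" "\<And>x y. k x - k y \<le> 7 * N (x - y)"
    "\<And>x. (u x + 5 * D x) - \<eta> \<le> k x" "\<And>x. k x \<le> (u x + 5 * D x) + \<eta>"
    using Lasry_Lions_regularization[of "\<lambda>x. u x + 5 * D x" 7 \<eta>] \<open>0 < \<eta>\<close> by auto
  \<comment> \<open>The default value \<open>f q\<close> makes the estimate off \<open>V\<close>
    hold on the whole manifold, including points outside the patch.\<close>
  define G where "G q = (if q \<in> patch \<kappa> S then k (chart_map \<kappa> q) - \<eta> else f q)" for q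
  have u_f: "u (chart_map \<kappa> q) = f q" if "q \<in> patch \<kappa> S" for q
    using that \<kappa> by (simp add: u(1) patch_def)
  have G_eq: "k x - \<eta> = (G \<circ> chart_inv \<kappa>) x" if "x \<in> S" for x
    using inv_patch[OF that] by (simp add: G_def)
  have k_shift: "C1_on UNIV (\<lambda>x. k x - \<eta>)"
  proof -
    have "C1_on UNIV (\<lambda>s. s - \<eta>)"
      by (rule C1_on_real[where f' = "\<lambda>_. 1"]) (auto intro!: derivative_eq_intros)
    from C1_on_compose[OF k(1) this] show ?thesis
      by (simp add: comp_def)
  qed
  show ?thesis
  proof (rule that[of G])
    show "C1_on S (G \<circ> chart_inv \<kappa>)"
      using S(1) C1_on_subset[OF k_shift subset_UNIV] G_eq by (rule C1_on_cong)
    fix q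
    show "G q \<le> f q + 5 * \<eta>" if "q \<in> patch \<kappa> S"
      using that k(4)[of "chart_map \<kappa> q"] D(3)[of "chart_map \<kappa> q"] by (simp add: G_def u_f)
    show "G q \<le> f q" if "q \<notin> V"
    proof (cases "q \<in> patch \<kappa> S")
      case True
      have "chart_map \<kappa> q \<notin> chart_map \<kappa> ` V"
      proof
        assume "chart_map \<kappa> q \<in> chart_map \<kappa> ` V"
        then obtain q' where q': "q' \<in> V" "chart_map \<kappa> q = chart_map \<kappa> q'"
          by blast
        have "q' \<in> chart_dom \<kappa>" "q \<in> chart_dom \<kappa>"
          using q'(1) V True by (auto simp: patch_def)
        then have "q = q'"
          using chart_inv_chart_map[OF \<kappa>] q'(2) by metis
        then show False
          using q'(1) that by simp
      qed
      then show ?thesis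
        using True k(4)[of "chart_map \<kappa> q"] D(4) by (simp add: G_def u_f)
    qed (simp add: G_def)
    show "f q + 3 * \<eta> \<le> G q" if "q \<in> V" "\<And>z. N (z - chart_map \<kappa> q) < \<eta> \<Longrightarrow> z \<in> chart_map \<kappa> ` V"
    proof -
      have "q \<in> patch \<kappa> S"
        using that(1) V by blast
      then show ?thesis
        using k(3)[of "chart_map \<kappa> q"] D(5)[OF that(2)] by (simp add: G_def u_f)
    qed
    fix v assume q: "q \<in> patch \<kappa> S" and v: "v \<in> tangent_space \<A> q"
    have "(G \<circ> chart_inv \<kappa> has_derivative frechet_derivative (G \<circ> chart_inv \<kappa>) (at (chart_map \<kappa> q))) (at (chart_map \<kappa> q))"
      using \<open>C1_on S (G \<circ> chart_inv \<kappa>)\<close> by (rule C1_on_derivative) (use q in \<open>simp add: patch_def\<close>)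
    then have "((\<lambda>x. k x - \<eta>) has_derivative frechet_derivative (G \<circ> chart_inv \<kappa>) (at (chart_map \<kappa> q))) (at (chart_map \<kappa> q))"
      by (rule has_derivative_transform_within_open[OF _ S(1)]) (use q G_eq in \<open>auto simp: patch_def\<close>)
    then have "\<bar>frechet_derivative (G \<circ> chart_inv \<kappa>) (at (chart_map \<kappa> q)) (v \<kappa>)\<bar> \<le> 7 * N (v \<kappa>)"
      by (rule derivative_bound) (use k(2) in simp)
    then show "\<bar>frechet_derivative (G \<circ> chart_inv \<kappa>) (at (chart_map \<kappa> q)) (v \<kappa>)\<bar> \<le> 14 * tangent_norm g q v"
      using metric[OF q v] by linarith
  qed
qed

end

section \<open>Gluing\<close>

context riemannian_manifold
begin

text \<open>All scales \<open>\<eta> n\<close> are used at once because the cover need not have a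
  uniform Lebesgue number: each point is deep inside some \<open>V\<close> only at a scale of its
  own, and at that scale it dominates all much finer ones.\<close>

proposition C1_approximation:
  assumes f: "chart_lipschitz f" and "0 < \<epsilon>"
  obtains T where "C1_function \<A> T"
    "\<And>q. q \<in> topspace X \<Longrightarrow> f q \<le> T q" "\<And>q. q \<in> topspace X \<Longrightarrow> T q \<le> f q + \<epsilon>"
    "\<And>\<kappa> q v. \<kappa> \<in> charts_at \<A> q \<Longrightarrow> v \<in> tangent_space \<A> q \<Longrightarrow>
      \<bar>frechet_derivative (T \<circ> chart_inv \<kappa>) (at (chart_map \<kappa> q)) (v \<kappa>)\<bar> \<le> 14 * tangent_norm g q v"
proof -
  obtain \<V> where \<V>: "\<forall>V\<in>\<V>. openin X V" "\<Union>\<V> = topspace X" "locally_finite_in X \<V>"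
    and patches: "\<forall>V\<in>\<V>. \<exists>\<kappa> B S. near_euclidean \<kappa> B S \<and> X closure_of V \<subseteq> patch \<kappa> S"
    using locally_finite_patch_cover by (elim exE conjE) (rule that; assumption)
  obtain \<kappa> B S where ne: "\<And>V. V \<in> \<V> \<Longrightarrow> near_euclidean (\<kappa> V) (B V) (S V)"
    and clos: "\<And>V. V \<in> \<V> \<Longrightarrow> X closure_of V \<subseteq> patch (\<kappa> V) (S V)"
    using patches by metis
  have V_clos: "V \<subseteq> X closure_of V" if "V \<in> \<V>" for V
    using \<V>(1) that by (simp add: closure_of_subset openin_subset)
  then have V_patch: "V \<subseteq> patch (\<kappa> V) (S V)" if "V \<in> \<V>" for V
    using clos[OF that] that by blast
  have \<kappa>: "\<kappa> V \<in> \<A>" "S V \<subseteq> image_of (\<kappa> V)" if "V \<in> \<V>" for V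
    using ne[OF that] by (simp_all add: near_euclidean_def)

  \<comment> \<open>The largest possible excess \<open>5 * \<eta> 0\<close> equals
    \<open>\<epsilon>\<close>. Two halvings give \<open>5 * \<eta> (m + 2) < 2 * \<eta> m\<close>,
    so scales beyond \<open>Suc m\<close> stay below the threshold used at scale
    \<open>m\<close>.\<close>
  define \<eta> where "\<eta> n = \<epsilon> / 5 * (1 / 2) ^ n" for n :: nat
  have \<eta>_pos: "0 < \<eta> n" for n
    using \<open>0 < \<epsilon>\<close> by (simp add: \<eta>_def)
  have \<eta>_0: "5 * \<eta> 0 = \<epsilon>"
    by (simp add: \<eta>_def)
  have \<eta>_mono: "\<eta> n \<le> \<eta> m" if "m \<le> n" for m n
    using \<open>0 < \<epsilon>\<close> power_decreasing[OF that, of "1 / 2 :: real"] by (simp add: \<eta>_def)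
  have \<eta>_2: "\<eta> (Suc (Suc m)) = \<eta> m / 4" for m
    by (simp add: \<eta>_def)
  have \<eta>_lim: "\<eta> \<longlonglongrightarrow> 0"
    unfolding \<eta>_def by (intro tendsto_mult_right_zero LIMSEQ_power_zero) simp

  define good where "good V n G \<longleftrightarrow> C1_on (S V) (G \<circ> chart_inv (\<kappa> V)) \<and>
    (\<forall>q. q \<in> patch (\<kappa> V) (S V) \<longrightarrow> G q \<le> f q + 5 * \<eta> n) \<and>
    (\<forall>q. q \<notin> V \<longrightarrow> G q \<le> f q) \<and>
    (\<forall>q. q \<in> V \<longrightarrow> (\<forall>z. equivalent_inner.N (B V) (z - chart_map (\<kappa> V) q) < \<eta> n \<longrightarrow> z \<in> chart_map (\<kappa> V) ` V) \<longrightarrow>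
       f q + 3 * \<eta> n \<le> G q) \<and>
    (\<forall>q v. q \<in> patch (\<kappa> V) (S V) \<longrightarrow> v \<in> tangent_space \<A> q \<longrightarrow>
       \<bar>frechet_derivative (G \<circ> chart_inv (\<kappa> V)) (at (chart_map (\<kappa> V) q)) (v (\<kappa> V))\<bar> \<le> 14 * tangent_norm g q v)"
    for V n G
  have "\<exists>G. good V n G" if "V \<in> \<V>" for V n
    by (rule local_approximation[OF ne[OF that] V_patch[OF that] f \<eta>_pos[of n]]) (unfold good_def, blast)
  then obtain G where good: "\<And>V n. V \<in> \<V> \<Longrightarrow> good V n (G V n)"
    by metis
  have G_C1: "C1_on (S V) (G V n \<circ> chart_inv (\<kappa> V))"
    and G_upper: "q \<in> patch (\<kappa> V) (S V) \<Longrightarrow> G V n q \<le> f q + 5 * \<eta> n"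
    and G_outside: "q \<notin> V \<Longrightarrow> G V n q \<le> f q"
    and G_deep: "q \<in> V \<Longrightarrow> (\<And>z. equivalent_inner.N (B V) (z - chart_map (\<kappa> V) q) < \<eta> n \<Longrightarrow> z \<in> chart_map (\<kappa> V) ` V) \<Longrightarrow>
       f q + 3 * \<eta> n \<le> G V n q"
    and G_derivative: "q \<in> patch (\<kappa> V) (S V) \<Longrightarrow> v \<in> tangent_space \<A> q \<Longrightarrow>
       \<bar>frechet_derivative (G V n \<circ> chart_inv (\<kappa> V)) (at (chart_map (\<kappa> V) q)) (v (\<kappa> V))\<bar> \<le> 14 * tangent_norm g q v"
    if "V \<in> \<V>" for V n q v
    using good[OF that, of n] unfolding good_def by blast+

  define I where "I = \<V> \<times> (UNIV :: nat set)"
  define GI where "GI i = G (fst i) (snd i)" for i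
  \<comment> \<open>Each function is measured in units of its own scale, so that an excess of
    \<open>\<eta> m\<close> at scale \<open>m\<close> contributes exactly 1 to the equation.\<close>
  define e where "e i = \<eta> (snd i)" for i :: "'m set \<times> nat"
  have e_pos: "0 < e i" for i
    by (simp add: e_def \<eta>_pos)

  \<comment> \<open>Local data that reduce the infinite family to a finite one: above the threshold
    \<open>f + 2 * \<eta> m\<close> only indices in \<open>J\<close> occur, and \<open>i0\<close>
    exceeds that threshold by at least one unit of its scale throughout \<open>N\<close>.\<close>
  define localized where "localized N m J i0 \<longleftrightarrow> openin X N \<and> finite J \<and> J \<subseteq> I \<and>
      (\<forall>i\<in>J. N \<subseteq> patch (\<kappa> (fst i)) (S (fst i))) \<and>
      (\<forall>q\<in>N. \<forall>i\<in>I. f q + 2 * \<eta> m < GI i q \<longrightarrow> i \<in> J) \<and>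
      i0 \<in> J \<and> snd i0 = m \<and> (\<forall>q\<in>N. f q + 3 * \<eta> m \<le> GI i0 q)"
    for N m J i0
  have ex_localized: "\<exists>N m J i0. q0 \<in> N \<and> localized N m J i0" if q0: "q0 \<in> topspace X" for q0
  proof -
    obtain N1 where N1: "openin X N1" "q0 \<in> N1" and fin: "finite {V \<in> \<V>. V \<inter> N1 \<noteq> {}}"
      using \<V>(3) q0 unfolding locally_finite_in_def by blast
    define F where "F = {V \<in> \<V>. V \<inter> N1 \<noteq> {}}"
    \<comment> \<open>Sets with \<open>q0\<close> in their closure have \<open>q0\<close> in their
      patch, and the neighbourhood is shrunk into those patches. The remaining sets in
      \<open>F\<close> are avoided by removing their closures.\<close>
    define F0 where "F0 = {V \<in> F. q0 \<in> X closure_of V}"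
    have "finite F"
      using fin by (simp add: F_def)
    then have "finite F0"
      by (simp add: F0_def)
    have F0_V: "V \<in> \<V>" if "V \<in> F0" for V
      using that by (simp add: F0_def F_def)
    obtain V0 where V0: "V0 \<in> \<V>" "q0 \<in> V0"
      using \<V>(2) q0 by blast
    then have "V0 \<in> F0"
      using V_clos N1(2) by (auto simp: F0_def F_def)
    interpret equivalent_inner "B V0"
      using ne[OF V0(1)] by (simp add: near_euclidean_def)
    obtain c where c: "c > 0" "\<And>v. c * norm v \<le> N v"
      using N_bounds by blast
    define x0 where "x0 = chart_map (\<kappa> V0) q0"
    have V0_dom: "V0 \<inter> chart_dom (\<kappa> V0) = V0"
      using V_patch[OF V0(1)] by (auto simp: patch_def)
    have "open (chart_map (\<kappa> V0) ` V0)"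
      using open_chart_image_Int[OF \<kappa>(1)[OF V0(1)], of V0] \<V>(1) V0(1) by (simp add: V0_dom)
    moreover have "x0 \<in> chart_map (\<kappa> V0) ` V0"
      using V0(2) by (simp add: x0_def)
    ultimately obtain \<rho> where \<rho>: "\<rho> > 0" "ball x0 \<rho> \<subseteq> chart_map (\<kappa> V0) ` V0"
      by (meson openE)
    \<comment> \<open>By the norm comparison, a ball of radius \<open>\<eta> m\<close> in
      \<open>N\<close> then has norm radius below \<open>\<rho> / 2\<close>. Around any point of the
      half ball \<open>Z\<close> it stays inside the image of \<open>V0\<close>, so all of
      \<open>Z\<close> has depth \<open>\<eta> m\<close>.\<close>
    have "\<forall>\<^sub>F m in sequentially. \<eta> m < c * \<rho> / 2"
      using \<eta>_lim c(1) \<rho>(1) by (intro order_tendstoD(2)) auto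
    then obtain m where m: "\<eta> m < c * \<rho> / 2"
      by (meson eventually_happens' sequentially_bot)
    define Z where "Z = {q \<in> chart_dom (\<kappa> V0). chart_map (\<kappa> V0) q \<in> ball x0 (\<rho> / 2)} \<inter> V0"
    have Z: "openin X Z"
      unfolding Z_def using \<V>(1) V0(1) by (intro openin_Int openin_chart_preimage[OF \<kappa>(1)[OF V0(1)] open_ball]) auto
    have "q0 \<in> Z"
      using V0 V0_dom \<rho>(1) by (auto simp: Z_def x0_def)
    define P where "P = topspace X \<inter> \<Inter>((\<lambda>V. patch (\<kappa> V) (S V)) ` F0)"
    define N' where "N' = N1 \<inter> Z \<inter> P - \<Union>((closure_of) X ` (F - F0))"
    have "openin X P"
      unfolding P_def using \<open>finite F0\<close> openin_patch[OF ne[OF F0_V]] by (intro openin_Int_Inter) auto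
    then have open_N': "openin X N'"
      unfolding N'_def using N1(1) Z \<open>finite F\<close>
      by (intro openin_diff openin_Int closedin_Union) auto
    have "q0 \<in> N'"
      using N1(2) \<open>q0 \<in> Z\<close> q0 clos F0_V by (auto simp: N'_def P_def F0_def)
    \<comment> \<open>A function above the threshold exceeds \<open>f\<close>, hence the point lies
      in its \<open>V\<close>, which therefore belongs to \<open>F0\<close>. The bound
      \<open>f + 5 * \<eta> n\<close> excludes all scales finer than \<open>Suc m\<close>.\<close>
    have capture: "i \<in> F0 \<times> {..Suc m}" if q: "q \<in> N'" and i: "i \<in> I" and large: "f q + 2 * \<eta> m < GI i q" for q i
    proof -
      obtain V n where Vn: "i = (V, n)" "V \<in> \<V>"
        using i by (auto simp: I_def)
      have "q \<in> V"
        using G_outside[OF Vn(2), of q n] large \<eta>_pos[of m] by (auto simp: GI_def Vn(1))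
      then have "V \<in> F0"
        using q V_clos[OF Vn(2)] Vn(2) by (auto simp: N'_def F_def F0_def)
      moreover have "n \<le> Suc m"
      proof (rule ccontr)
        assume "\<not> n \<le> Suc m"
        then have "\<eta> n \<le> \<eta> m / 4"
          using \<eta>_mono[of "Suc (Suc m)" n] by (simp add: \<eta>_2)
        moreover have "G V n q \<le> f q + 5 * \<eta> n"
          using G_upper[OF Vn(2)] V_patch[OF Vn(2)] \<open>q \<in> V\<close> by blast
        ultimately show False
          using large \<eta>_pos[of m] by (simp add: GI_def Vn(1))
      qed
      ultimately show ?thesis
        by (simp add: Vn(1))
    qed
    have deep: "f q + 3 * \<eta> m \<le> GI (V0, m) q" if q: "q \<in> N'" for q
      unfolding GI_def fst_conv snd_conv
    proof (rule G_deep[OF V0(1)])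
      show "q \<in> V0"
        using q by (simp add: N'_def Z_def)
      fix z assume "N (z - chart_map (\<kappa> V0) q) < \<eta> m"
      then have "c * norm (z - chart_map (\<kappa> V0) q) < c * (\<rho> / 2)"
        using c(2)[of "z - chart_map (\<kappa> V0) q"] m by simp
      then have "dist z (chart_map (\<kappa> V0) q) < \<rho> / 2"
        using c(1) by (simp add: dist_norm)
      moreover have "dist x0 (chart_map (\<kappa> V0) q) < \<rho> / 2"
        using q by (simp add: N'_def Z_def)
      ultimately have "dist x0 z < \<rho>"
        using dist_triangle2[of x0 z "chart_map (\<kappa> V0) q"] by linarith
      then show "z \<in> chart_map (\<kappa> V0) ` V0"
        using \<rho>(2) by auto
    qed
    have "localized N' m (F0 \<times> {..Suc m}) (V0, m)"
      unfolding localized_def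
    proof (intro conjI ballI impI)
      show "F0 \<times> {..Suc m} \<subseteq> I"
        using F0_V by (auto simp: I_def)
      show "N' \<subseteq> patch (\<kappa> (fst i)) (S (fst i))" if "i \<in> F0 \<times> {..Suc m}" for i
        using that by (auto simp: N'_def P_def)
    qed (use open_N' \<open>finite F0\<close> \<open>V0 \<in> F0\<close> capture deep in auto)
    with \<open>q0 \<in> N'\<close> show ?thesis
      by blast
  qed

  define active where "active q t = {i \<in> I. t < GI i q}" for q t
  \<comment> \<open>The equation is stated through the active indices, which depend on
    \<open>q\<close> and \<open>t\<close> alone. A solution can thus be chosen globally, and
    \<open>sum_J\<close> identifies the equation with a fixed finite sum on each
    neighbourhood.\<close>
  define solves where "solves q t \<longleftrightarrow> t \<le> f q + \<epsilon> \<and> finite (active q t) \<and>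
    (\<Sum>i\<in>active q t. possq ((GI i q - t) / e i)) = 1" for q t
  have sum_J: "active q t \<subseteq> J \<and> (\<Sum>i\<in>active q t. possq ((GI i q - t) / e i)) = (\<Sum>i\<in>J. possq ((GI i q - t) / e i))"
    if loc: "localized N m J i0" and q: "q \<in> N" and t: "f q + 2 * \<eta> m \<le> t" for N m J i0 q t
  proof
    show sub: "active q t \<subseteq> J"
    proof
      fix i assume "i \<in> active q t"
      then have "i \<in> I" "f q + 2 * \<eta> m < GI i q"
        using t by (auto simp: active_def)
      then show "i \<in> J"
        using loc q unfolding localized_def by blast
    qed
    show "(\<Sum>i\<in>active q t. possq ((GI i q - t) / e i)) = (\<Sum>i\<in>J. possq ((GI i q - t) / e i))"
    proof (rule sum.mono_neutral_left)
      show "finite J"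
        using loc by (simp add: localized_def)
      show "\<forall>i\<in>J - active q t. possq ((GI i q - t) / e i) = 0"
        using loc e_pos by (auto simp: active_def localized_def not_less intro!: possq_nonpos divide_nonpos_pos)
    qed (rule sub)
  qed
  have "\<exists>t. solves q t" if q: "q \<in> topspace X" for q
  proof -
    obtain N m J i0 where "q \<in> N" and loc: "localized N m J i0"
      using ex_localized[OF q] by blast
    have J: "finite J" "i0 \<in> J" "e i0 = \<eta> m" "f q + 3 * \<eta> m \<le> GI i0 q"
      using loc \<open>q \<in> N\<close> by (auto simp: localized_def e_def)
    \<comment> \<open>Intermediate value argument: at \<open>f q + 2 * \<eta> m\<close> the term of
      \<open>i0\<close> alone is at least 1, and at \<open>f q + \<epsilon>\<close> every term
      vanishes.\<close>
    define \<Psi> where "\<Psi> t = (\<Sum>i\<in>J. possq ((GI i q - t) / e i))" for t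
    have le: "f q + 2 * \<eta> m \<le> f q + \<epsilon>"
      using \<eta>_mono[of 0 m] \<eta>_0 \<eta>_pos[of 0] by simp
    have "possq ((GI i0 q - (f q + 2 * \<eta> m)) / e i0) \<le> \<Psi> (f q + 2 * \<eta> m)"
      unfolding \<Psi>_def by (rule member_le_sum) (use J in auto)
    moreover have "possq 1 \<le> possq ((GI i0 q - (f q + 2 * \<eta> m)) / e i0)"
      using J \<eta>_pos[of m] by (intro possq_mono) (simp add: pos_le_divide_eq)
    ultimately have "1 \<le> \<Psi> (f q + 2 * \<eta> m)"
      by (simp add: possq_def)
    moreover have "GI i q \<le> f q + \<epsilon>" if "i \<in> J" for i
    proof -
      have "fst i \<in> \<V>" "q \<in> patch (\<kappa> (fst i)) (S (fst i))"
        using loc that \<open>q \<in> N\<close> by (auto simp: localized_def I_def)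
      then show ?thesis
        using G_upper[of "fst i" q "snd i"] \<eta>_mono[of 0 "snd i"] \<eta>_0 by (simp add: GI_def)
    qed
    then have "\<Psi> (f q + \<epsilon>) = 0"
      unfolding \<Psi>_def using e_pos by (intro sum.neutral) (auto intro!: possq_nonpos divide_nonpos_pos)
    moreover have "continuous_on {f q + 2 * \<eta> m..f q + \<epsilon>} \<Psi>"
      unfolding \<Psi>_def using e_pos by (intro continuous_intros) (auto simp: less_imp_neq[symmetric])
    ultimately obtain t where t: "f q + 2 * \<eta> m \<le> t" "t \<le> f q + \<epsilon>" "\<Psi> t = 1"
      using IVT2'[of \<Psi> "f q + \<epsilon>" 1 "f q + 2 * \<eta> m"] le by auto
    then show ?thesis
      using sum_J[OF loc \<open>q \<in> N\<close> t(1)] J(1) unfolding solves_def \<Psi>_def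
      by (intro exI[of _ t]) (auto intro: finite_subset)
  qed
  \<comment> \<open>No regularity enters the choice: \<open>smooth_max\<close> derives that
    \<open>T\<close> is C^1 from the equation.\<close>
  then obtain T where T: "\<And>q. q \<in> topspace X \<Longrightarrow> solves q (T q)"
    by metis
  have N_top: "N \<subseteq> topspace X" if "localized N m J i0" for N m J i0
    using that by (auto simp: localized_def dest: openin_subset)
  \<comment> \<open>A solution below the threshold would make the term of \<open>i0\<close> alone
    larger than 1. Hence every solution lies in the range where \<open>sum_J\<close>
    applies.\<close>
  have T_lower: "f q + 2 * \<eta> m \<le> T q" if loc: "localized N m J i0" and q: "q \<in> N" for N m J i0 q
  proof (rule ccontr)
    assume "\<not> ?thesis"
    then have less: "T q < f q + 2 * \<eta> m"
      by simp
    have i0: "i0 \<in> I" "e i0 = \<eta> m" "f q + 3 * \<eta> m \<le> GI i0 q"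
      using loc q by (auto simp: localized_def e_def)
    have sol: "solves q (T q)"
      using T N_top[OF loc] q by blast
    have "possq ((GI i0 q - T q) / e i0) \<le> (\<Sum>i\<in>active q (T q). possq ((GI i q - T q) / e i))"
      using sol less i0 \<eta>_pos[of m]
      by (intro member_le_sum[of i0 _ "\<lambda>i. possq ((GI i q - T q) / e i)"]) (auto simp: solves_def active_def)
    moreover have "possq 1 < possq ((GI i0 q - T q) / e i0)"
      using less i0 \<eta>_pos[of m] by (intro possq_strict_mono) (simp_all add: pos_less_divide_eq)
    ultimately show False
      using sol by (simp add: solves_def possq_def)
  qed
  have smax: "smooth_max (chart_map \<mu> ` (N \<inter> chart_dom \<mu>)) J (\<lambda>i. GI i \<circ> chart_inv \<mu>) e (T \<circ> chart_inv \<mu>)"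
    if \<mu>: "\<mu> \<in> \<A>" and loc: "localized N m J i0" for \<mu> N m J i0
  proof
    have N: "openin X N" "finite J" and J: "\<And>i. i \<in> J \<Longrightarrow> fst i \<in> \<V> \<and> N \<subseteq> patch (\<kappa> (fst i)) (S (fst i))"
      using loc by (auto simp: localized_def I_def)
    show "open (chart_map \<mu> ` (N \<inter> chart_dom \<mu>))"
      using \<mu> N(1) by (rule open_chart_image_Int)
    show "finite J"
      by (rule N(2))
    show "C1_on (chart_map \<mu> ` (N \<inter> chart_dom \<mu>)) (GI i \<circ> chart_inv \<mu>)" if i: "i \<in> J" for i
    proof (rule C1_on_change_chart[OF \<mu> \<kappa>(1) N(1)])
      show "fst i \<in> \<V>" "N \<subseteq> chart_dom (\<kappa> (fst i))"
        using J[OF i] by (auto simp: patch_def)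
      show "C1_on (chart_map (\<kappa> (fst i)) ` N) (GI i \<circ> chart_inv (\<kappa> (fst i)))"
        unfolding GI_def using J[OF i] by (intro C1_on_subset[OF G_C1]) (auto simp: patch_def)
    qed
    show "0 < e i" for i
      by (rule e_pos)
    fix x assume "x \<in> chart_map \<mu> ` (N \<inter> chart_dom \<mu>)"
    then obtain q where q: "q \<in> N" "chart_inv \<mu> x = q"
      using \<mu> by auto
    have "solves q (T q)"
      using T N_top[OF loc] q(1) by blast
    then show "(\<Sum>i\<in>J. possq (((GI i \<circ> chart_inv \<mu>) x - (T \<circ> chart_inv \<mu>) x) / e i)) = 1"
      using sum_J[OF loc q(1) T_lower[OF loc q(1)]] by (simp add: solves_def q(2))
  qed
  show thesis
  proof
    show "C1_function \<A> T"
      unfolding C1_function_def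
    proof (intro ballI C1_on_local)
      fix \<mu> x assume \<mu>: "\<mu> \<in> \<A>" and x: "x \<in> image_of \<mu>"
      then obtain q where q: "q \<in> chart_dom \<mu>" "x = chart_map \<mu> q"
        by blast
      then have "q \<in> topspace X"
        using chart_dom_subset[OF \<mu>] by blast
      then obtain N m J i0 where "q \<in> N" and loc: "localized N m J i0"
        using ex_localized by blast
      interpret smooth_max "chart_map \<mu> ` (N \<inter> chart_dom \<mu>)" J "\<lambda>i. GI i \<circ> chart_inv \<mu>" e "T \<circ> chart_inv \<mu>"
        by (rule smax[OF \<mu> loc])
      show "\<exists>W. open W \<and> x \<in> W \<and> C1_on W (T \<circ> chart_inv \<mu>)"
        using open_W C1_on_T q \<open>q \<in> N\<close> by blast
    qed
    fix q
    show "T q \<le> f q + \<epsilon>" if "q \<in> topspace X"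
      using T[OF that] by (simp add: solves_def)
    show "f q \<le> T q" if q: "q \<in> topspace X"
    proof -
      obtain N m J i0 where "q \<in> N" and loc: "localized N m J i0"
        using ex_localized[OF q] by blast
      then show ?thesis
        using T_lower[OF loc \<open>q \<in> N\<close>] \<eta>_pos[of m] by simp
    qed
    fix \<mu> v assume \<mu>: "\<mu> \<in> charts_at \<A> q" and v: "v \<in> tangent_space \<A> q"
    have \<mu>': "\<mu> \<in> \<A>" "q \<in> chart_dom \<mu>"
      using \<mu> by (auto simp: charts_at_def)
    then have "q \<in> topspace X"
      using chart_dom_subset by blast
    then obtain N m J i0 where "q \<in> N" and loc: "localized N m J i0"
      using ex_localized by blast
    interpret smooth_max "chart_map \<mu> ` (N \<inter> chart_dom \<mu>)" J "\<lambda>i. GI i \<circ> chart_inv \<mu>" e "T \<circ> chart_inv \<mu>"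
      by (rule smax[OF \<mu>'(1) loc])
    show "\<bar>frechet_derivative (T \<circ> chart_inv \<mu>) (at (chart_map \<mu> q)) (v \<mu>)\<bar> \<le> 14 * tangent_norm g q v"
    proof (rule T_derivative_bound)
      show "chart_map \<mu> q \<in> chart_map \<mu> ` (N \<inter> chart_dom \<mu>)"
        using \<open>q \<in> N\<close> \<mu>'(2) by blast
      fix i assume i: "i \<in> J"
      define \<nu> where "\<nu> = \<kappa> (fst i)"
      have V: "fst i \<in> \<V>" and q_patch: "q \<in> patch \<nu> (S (fst i))"
        using loc i \<open>q \<in> N\<close> by (auto simp: localized_def I_def \<nu>_def)
      then have \<nu>: "\<nu> \<in> charts_at \<A> q"
        using \<kappa>(1)[OF V] by (simp add: \<nu>_def charts_at_def patch_def)
      \<comment> \<open>The bound for the differential is known in the chart \<open>\<nu>\<close> of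
        the patch. The chain rule, together with the transformation rule of tangent vectors, carries
        it over to \<open>\<mu>\<close>.\<close>
      have "(GI i \<circ> chart_inv \<nu> has_derivative frechet_derivative (GI i \<circ> chart_inv \<nu>) (at (chart_map \<nu> q))) (at (chart_map \<nu> q))"
        unfolding GI_def \<nu>_def using G_C1[OF V] by (rule C1_on_derivative) (use q_patch in \<open>simp add: patch_def \<nu>_def\<close>)
      from frechet_derivative_at[OF derivative_change_chart[OF \<mu> \<nu> this], symmetric]
      have "frechet_derivative (GI i \<circ> chart_inv \<mu>) (at (chart_map \<mu> q)) (v \<mu>) =
          frechet_derivative (GI i \<circ> chart_inv \<nu>) (at (chart_map \<nu> q)) (v \<nu>)"
        by (simp only: o_apply tangent_space_change_chart[OF v \<mu> \<nu>])
      also have "\<bar>\<dots>\<bar> \<le> 14 * tangent_norm g q v"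
        unfolding GI_def \<nu>_def by (rule G_derivative[OF V _ v]) (use q_patch in \<open>simp add: \<nu>_def\<close>)
      finally show "\<bar>frechet_derivative (GI i \<circ> chart_inv \<mu>) (at (chart_map \<mu> q)) (v \<mu>)\<bar> \<le> 14 * tangent_norm g q v" .
    qed
  qed
qed

end

section \<open>Bump functions\<close>

text \<open>Passes from the extended-real distance to a real function: clamping to the interval from
  0 to \<open>\<delta>\<close> is monotone and does not enlarge differences, also at infinite
  values.\<close>

lemma clamp_le_add:
  fixes x y :: ereal
  assumes "x \<le> y + ereal K" "0 \<le> K" "0 \<le> \<delta>"
  shows "real_of_ereal (max 0 (min (ereal \<delta>) x)) \<le> real_of_ereal (max 0 (min (ereal \<delta>) y)) + K"
  using assms by (cases x; cases y) (auto simp: max_def min_def)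

text \<open>The quadratic spline equal to 1 for \<open>y \<le> 0\<close>, to
  \<open>1 - 2 * y\<^sup>2\<close> up to \<open>1 / 2\<close>, to \<open>2 * (1 - y)\<^sup>2\<close>
  up to 1, and to 0 afterwards. Its derivative is a tent with extreme value -2 at
  \<open>1 / 2\<close>.\<close>

definition cutoff :: "real \<Rightarrow> real" where
  "cutoff y = 1 - 2 * possq y + 4 * possq (y - 1 / 2) - 2 * possq (y - 1)"

definition cutoff' :: "real \<Rightarrow> real" where
  "cutoff' y = - 4 * max 0 y + 8 * max 0 (y - 1 / 2) - 4 * max 0 (y - 1)"

lemma cutoff_has_derivative: "(cutoff has_real_derivative cutoff' y) (at y)"
proof -
  have "((\<lambda>z. possq (z - c)) has_real_derivative 2 * max 0 (y - c) * 1) (at y)" for c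
    by (rule DERIV_chain2[OF possq_has_derivative]) (auto intro!: derivative_eq_intros)
  note this[of "1 / 2"] this[of 1]
  then show ?thesis
    unfolding cutoff_def[abs_def] cutoff'_def
    by (auto intro!: derivative_eq_intros possq_has_derivative)
qed

lemma cutoff'_bound: "\<bar>cutoff' y\<bar> \<le> 2"
  by (auto simp: cutoff'_def max_def)

lemma cutoff_eq_1: "y \<le> 0 \<Longrightarrow> cutoff y = 1"
  by (simp add: cutoff_def)

lemma cutoff_eq_0: "1 \<le> y \<Longrightarrow> cutoff y = 0"
  by (simp add: cutoff_def possq_def power2_eq_square field_simps)

lemma cutoff_range: "0 \<le> cutoff y \<and> cutoff y \<le> 1"
proof -
  consider "y \<le> 0" | "0 \<le> y" "y \<le> 1 / 2" | "1 / 2 \<le> y" "y \<le> 1" | "1 \<le> y"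
    by linarith
  then show ?thesis
  proof cases
    case 2
    then have "y\<^sup>2 \<le> (1 / 2)\<^sup>2"
      by (intro power_mono) auto
    then show ?thesis
      using 2 by (simp add: cutoff_def possq_def power2_eq_square)
  next
    case 3
    then have "(1 - y)\<^sup>2 \<le> (1 / 2)\<^sup>2"
      by (intro power_mono) auto
    moreover have "cutoff y = 2 * (1 - y)\<^sup>2"
      using 3 by (simp add: cutoff_def possq_def power2_eq_square field_simps)
    ultimately show ?thesis
      by (simp add: power2_eq_square)
  qed (simp_all add: cutoff_eq_0 cutoff_eq_1)
qed

context riemannian_manifold
begin

text \<open>As \<open>differential\<close> is evaluated in an unspecified chart around
  \<open>q\<close>, the bound is requested in all of them.\<close>

lemma differential_norm_le:
  assumes q: "q \<in> topspace X"
    and bound: "\<And>\<kappa> v. \<kappa> \<in> charts_at \<A> q \<Longrightarrow> v \<in> tangent_space \<A> q \<Longrightarrow> tangent_norm g q v \<le> 1 \<Longrightarrow>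
      \<bar>frechet_derivative (b \<circ> chart_inv \<kappa>) (at (chart_map \<kappa> q)) (v \<kappa>)\<bar> \<le> K"
  shows "differential_norm \<A> g b q \<le> ereal K"
proof -
  have "\<exists>\<kappa>. \<kappa> \<in> charts_at \<A> q"
    using atlas_covers q unfolding charts_at_def by blast
  then have "(SOME \<kappa>. \<kappa> \<in> charts_at \<A> q) \<in> charts_at \<A> q"
    by (rule someI_ex)
  then show ?thesis
    unfolding differential_norm_def differential_def Let_def
    by (intro SUP_least) (simp add: bound)
qed

proposition uniformly_bumpable: "C1_uniformly_bumpable X \<A> g"
  unfolding C1_uniformly_bumpable_def
\<comment> \<open>One witness serves for both \<open>R\<close> and \<open>r\<close>. The factors are
  14 from the approximation, 2 from \<open>cutoff\<close> and \<open>4 / (3 * \<delta>)\<close> from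
  rescaling, and \<open>112 / 3 < 38\<close>.\<close>
proof (intro exI[of _ "38::real"] conjI ballI allI impI)
  show "(1::real) < 38" "(0::real) < 38"
    by simp_all
  fix p and \<delta> :: real
  assume p: "p \<in> topspace X" and "0 < \<delta> \<and> \<delta> < 38"
  then have \<delta>: "0 < \<delta>"
    by simp
  \<comment> \<open>Clamping from below makes it unnecessary to know that the distance is nonnegative.\<close>
  define f where "f q = real_of_ereal (max 0 (min (ereal \<delta>) (riemannian_dist X \<A> g p q)))" for q
  have f_p: "f p = 0"
    using riemannian_dist_self_le[OF p] by (simp add: f_def max_absorb1 min.coboundedI2)
  have f_far: "f q = \<delta>" if "ereal \<delta> \<le> riemannian_dist X \<A> g p q" for q
    using that \<delta> by (simp add: f_def min_absorb1 max_absorb2)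
  have "chart_lipschitz f"
    unfolding chart_lipschitz_def
  proof (intro allI impI ballI)
    fix \<kappa> B S q q'
    assume ne: "near_euclidean \<kappa> B S" and q: "q \<in> patch \<kappa> S" and q': "q' \<in> patch \<kappa> S"
    interpret equivalent_inner B
      using ne by (simp add: near_euclidean_def)
    show "f q' \<le> f q + 2 * N (chart_map \<kappa> q' - chart_map \<kappa> q)"
      unfolding f_def using q q' \<delta>
      by (intro clamp_le_add riemannian_dist_chart_le[OF ne]) (auto simp: patch_def)
  qed
  then obtain T where T: "C1_function \<A> T"
    "\<And>q. q \<in> topspace X \<Longrightarrow> f q \<le> T q" "\<And>q. q \<in> topspace X \<Longrightarrow> T q \<le> f q + \<delta> / 4"
    and T_derivative: "\<And>\<kappa> q v. \<kappa> \<in> charts_at \<A> q \<Longrightarrow> v \<in> tangent_space \<A> q \<Longrightarrow>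
      \<bar>frechet_derivative (T \<circ> chart_inv \<kappa>) (at (chart_map \<kappa> q)) (v \<kappa>)\<bar> \<le> 14 * tangent_norm g q v"
    using C1_approximation[of f "\<delta> / 4"] \<delta> by (metis divide_pos_pos zero_less_numeral)
  \<comment> \<open>The affine map sends \<open>\<delta> / 4\<close> to 0 and
    \<open>\<delta>\<close> to 1. At \<open>p\<close> the approximation is at most
    \<open>\<delta> / 4\<close>, and at points of distance at least \<open>\<delta>\<close> it is at
    least \<open>\<delta>\<close>.\<close>
  define h where "h s = cutoff ((s - \<delta> / 4) * (4 / (3 * \<delta>)))" for s
  define h' where "h' s = cutoff' ((s - \<delta> / 4) * (4 / (3 * \<delta>))) * (4 / (3 * \<delta>))" for s
  have h_deriv: "(h has_real_derivative h' s) (at s)" for s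
    unfolding h_def[abs_def] h'_def
    by (rule DERIV_chain2[OF cutoff_has_derivative]) (use \<delta> in \<open>auto intro!: derivative_eq_intros\<close>)
  have h_C1: "C1_on UNIV h"
    using h_deriv by (rule C1_on_real) (unfold h'_def cutoff'_def, intro continuous_intros)
  have h'_bound: "\<bar>h' s\<bar> \<le> 8 / (3 * \<delta>)" for s
    using mult_right_mono[OF cutoff'_bound, of "4 / (3 * \<delta>)" "(s - \<delta> / 4) * (4 / (3 * \<delta>))"] \<delta>
    by (simp add: h'_def abs_mult)
  show "\<exists>b. C1_function \<A> b \<and> (\<forall>q\<in>topspace X. 0 \<le> b q \<and> b q \<le> 1) \<and> b p = 1 \<and>
      (\<forall>q\<in>topspace X. ereal \<delta> \<le> riemannian_dist X \<A> g p q \<longrightarrow> b q = 0) \<and>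
      (SUP q\<in>topspace X. differential_norm \<A> g b q) \<le> ereal (38 / \<delta>)"
  proof (intro exI[of _ "h \<circ> T"] conjI ballI impI)
    show "C1_function \<A> (h \<circ> T)"
      using T(1) unfolding C1_function_def comp_assoc by (intro ballI C1_on_compose[OF _ h_C1]) auto
    show "0 \<le> (h \<circ> T) q" "(h \<circ> T) q \<le> 1" for q
      using cutoff_range by (simp_all add: h_def)
    have "(T p - \<delta> / 4) * (4 / (3 * \<delta>)) \<le> 0"
      using T(3)[OF p] \<delta> by (intro mult_nonpos_nonneg) (simp_all add: f_p)
    then show "(h \<circ> T) p = 1"
      unfolding h_def o_apply by (rule cutoff_eq_1)
    show "(h \<circ> T) q = 0" if "q \<in> topspace X" "ereal \<delta> \<le> riemannian_dist X \<A> g p q" for q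
    proof -
      have "1 \<le> (T q - \<delta> / 4) * (4 / (3 * \<delta>))"
        using T(2)[OF that(1)] f_far[OF that(2)] \<delta> by (simp add: field_simps)
      then show ?thesis
        unfolding h_def o_apply by (rule cutoff_eq_0)
    qed
    show "(SUP q\<in>topspace X. differential_norm \<A> g (h \<circ> T) q) \<le> ereal (38 / \<delta>)"
    proof (intro SUP_least differential_norm_le)
      fix q \<kappa> v
      assume \<kappa>: "\<kappa> \<in> charts_at \<A> q" and v: "v \<in> tangent_space \<A> q" "tangent_norm g q v \<le> 1"
      have \<kappa>': "\<kappa> \<in> \<A>" "q \<in> chart_dom \<kappa>"
        using \<kappa> by (auto simp: charts_at_def)
      let ?D = "frechet_derivative (T \<circ> chart_inv \<kappa>) (at (chart_map \<kappa> q))"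
      have "(T \<circ> chart_inv \<kappa> has_derivative ?D) (at (chart_map \<kappa> q))"
        using T(1) \<kappa>' by (intro C1_on_derivative) (auto simp: C1_function_def)
      then have "(h \<circ> (T \<circ> chart_inv \<kappa>) has_derivative (*) (h' (T q)) \<circ> ?D) (at (chart_map \<kappa> q))"
        using h_deriv[of "T q"] \<kappa>' by (intro diff_chain_at) (auto simp: has_field_derivative_def)
      from fun_cong[OF frechet_derivative_at[OF this], of "v \<kappa>"]
      have "\<bar>frechet_derivative ((h \<circ> T) \<circ> chart_inv \<kappa>) (at (chart_map \<kappa> q)) (v \<kappa>)\<bar> = \<bar>h' (T q)\<bar> * \<bar>?D (v \<kappa>)\<bar>"
        unfolding comp_assoc by (simp flip: abs_mult)
      also have "\<dots> \<le> 8 / (3 * \<delta>) * 14"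
        using h'_bound T_derivative[OF \<kappa> v(1)] v(2) \<delta> by (intro mult_mono) auto
      also have "\<dots> \<le> 38 / \<delta>"
        using \<delta> by (simp add: field_simps)
      finally show "\<bar>frechet_derivative ((h \<circ> T) \<circ> chart_inv \<kappa>) (at (chart_map \<kappa> q)) (v \<kappa>)\<bar> \<le> 38 / \<delta>" .
    qed
  qed
qed

end

theorem corollary4p4:
  fixes X :: "'m topology"
    and \<A> :: "('m, 'e::{real_inner, banach}) chart set"
    and g :: "'m \<Rightarrow> ('m, 'e) tangent \<Rightarrow> ('m, 'e) tangent \<Rightarrow> real"
  assumes "riemannian_manifold X \<A> g"
  shows "C1_uniformly_bumpable X \<A> g"
  using assms by (rule riemannian_manifold.uniformly_bumpable)

end
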